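(* Let $r,s>0$, let $X$ be an exponentially distributed random variable with rate parameter $\lambda>0$ and distribution $P$, and let $(\alpha_n)_{n\ge1}$ be an $L^r(P)$-optimal sequence of quantizers. (a) If $s\in(r,r+1)\cup(r+1,+\infty)$, the sequence $(\alpha_n^{\theta,0})_{n\ge1}$ is $L^s(P)$-rate-optimal if and only if $\theta\in\bigl(s/(r+1),+\infty\bigr)$, and $$\theta^\star=(s+1)/(r+1)$$ is the unique minimizer of $\theta\mapsto Q_{r,s}^{\mathrm{Sup}}(P,\theta)$ on $\bigl(s/(r+1),+\infty\bigr)$. (b) If $s\in(0,r)$, the sequence $(\alpha_n^{\theta,0})_{n\ge1}$ is $L^s(P)$-rate-optimal for all $\theta\in\bigl(s/r,+\infty\bigr)$, and $$\theta^\star=(s+1)/(r+1)$$ is the unique minimizer of $\theta\mapsto Q_{r,s}^{\mathrm{Sup}}(P,\theta)$ on $\bigl(s/r,+\infty\bigr)$.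
   Context: Here the dimension is $d=1$; $d(x,\alpha)=\min_{a\in\alpha}|x-a|$ for a finite nonempty $\alpha\subset\mathbb{R}$. A sequence of quantizers $(\alpha_n)_{n\ge1}$ is a sequence of finite nonempty sets $\alpha_n\subset\mathbb{R}$ with $\mathrm{card}(\alpha_n)\le n$; it is $L^r(P)$-optimal if for all $n\ge1$, $\int d(x,\alpha_n)^r dP(x)=e_{n,r}^r(P):=\inf_{\mathrm{card}(\alpha)\le n}\int d(x,\alpha)^r dP(x)$. A sequence $(\beta_n)$ is $L^s(P)$-rate-optimal if $\limsup_n n^{s}\int d(x,\beta_n)^s dP(x)<+\infty$. For $\theta>0$: $\alpha_n^{\theta,0}=\theta\alpha_n=\{\theta a:a\in\alpha_n\}$. $f(x)=\lambda e^{-\lambda x}\mathbf{1}_{\{x>0\}}$ is the density of $P$, and $f_\theta(x)=f(\theta x)$. With $J_{r,1}=\inf_{n\ge1}n^{r}e_{n,r}^r(U([0,1]))$ ($U([0,1])$ uniform distribution) and $Q_r(P)=J_{r,1}\left(\int f^{1/(1+r)}dx\right)^{1+r}$, set (with translating number $\mu=0$) $$Q_{r,s}^{\mathrm{Sup}}(P,\theta)=\begin{cases}\theta^{s+1}\,(Q_r(P))^{s/r}\left(\int_{\{f>0\}}f_{\theta}^{\frac{r}{r-s}}f^{-\frac{s}{r-s}}dx\right)^{1-\frac sr}&\text{if }s<r,\\[1ex]\theta^{s+1}\,C(b)\int_{\{f>0\}}f_{\theta}f^{-\frac{s}{1+r}}dx&\text{if }s>r,\end{cases}$$ where $C(b)>0$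 is a fixed constant not depending on $\theta$ (its value is irrelevant for the minimization). *)

theory Defs
  imports "HOL-Probability.Probability"
begin

definition quantizer :: "nat \<Rightarrow> real set \<Rightarrow> bool" where
  "quantizer n \<alpha> \<longleftrightarrow> finite \<alpha> \<and> \<alpha> \<noteq> {} \<and> card \<alpha> \<le> n"

definition quant_dist :: "real \<Rightarrow> real set \<Rightarrow> real" where
  "quant_dist x \<alpha> = Min ((\<lambda>a. \<bar>x - a\<bar>) ` \<alpha>)"

definition distortion :: "real \<Rightarrow> real measure \<Rightarrow> real set \<Rightarrow> ennreal" where
  "distortion r P \<alpha> = (\<integral>\<^sup>+ x. ennreal (quant_dist x \<alpha> powr r) \<partial>P)"

text \<open>The \<open>r\<close>-th power of the \<open>L\<^sup>r\<close> quantization error at level \<open>n\<close>.\<close>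

definition min_distortion :: "real \<Rightarrow> nat \<Rightarrow> real measure \<Rightarrow> ennreal" where
  "min_distortion r n P = (INF \<alpha>\<in>{\<alpha>. quantizer n \<alpha>}. distortion r P \<alpha>)"

definition optimal_quantizers :: "real \<Rightarrow> real measure \<Rightarrow> (nat \<Rightarrow> real set) \<Rightarrow> bool" where
  "optimal_quantizers r P \<alpha> \<longleftrightarrow>
     (\<forall>n\<ge>1. quantizer n (\<alpha> n) \<and> distortion r P (\<alpha> n) = min_distortion r n P)"

definition rate_optimal :: "real \<Rightarrow> real measure \<Rightarrow> (nat \<Rightarrow> real set) \<Rightarrow> bool" where
  "rate_optimal s P \<beta> \<longleftrightarrow>
     limsup (\<lambda>n. ennreal (real n powr s) * distortion s P (\<beta> n)) < \<infinity>"

text \<open>Real powers of extended nonnegative reals; meant for positive exponents only, so that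
  \<open>\<infinity>\<close> is mapped to \<open>\<infinity>\<close>.\<close>

definition ennreal_powr :: "ennreal \<Rightarrow> real \<Rightarrow> ennreal" where
  "ennreal_powr x p = (if x = \<infinity> then \<infinity> else ennreal (enn2real x powr p))"

definition J_const :: "real \<Rightarrow> ennreal" where
  "J_const r = (INF n\<in>{1..}.
     ennreal (real n powr r) * min_distortion r n (uniform_measure lborel {0..1}))"

text \<open>Here and below \<open>f\<close> is a Lebesgue density of the distribution \<open>P\<close>.\<close>

definition Q_const :: "real \<Rightarrow> (real \<Rightarrow> real) \<Rightarrow> ennreal" where
  "Q_const r f =
     J_const r * ennreal_powr (\<integral>\<^sup>+ x. ennreal (f x powr (1 / (1 + r))) \<partial>lborel) (1 + r)"

text \<open>The value lives in \<open>[0, \<infinity>]\<close>, so that a divergent integral yields \<open>\<infinity>\<close> rather than a default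
  value. The translating number is \<open>0\<close>, hence \<open>f\<^sub>\<theta> x = f (\<theta> * x)\<close>; the argument \<open>C\<close> is
  the constant \<open>C(b)\<close>. The quantity is only meaningful for \<open>s \<noteq> r\<close>.\<close>

definition Q_Sup :: "real \<Rightarrow> real \<Rightarrow> real \<Rightarrow> (real \<Rightarrow> real) \<Rightarrow> real \<Rightarrow> ennreal" where
  "Q_Sup r s C f \<theta> =
     (if s < r then
        ennreal (\<theta> powr (s + 1)) * ennreal_powr (Q_const r f) (s / r) *
        ennreal_powr
          (\<integral>\<^sup>+ x\<in>{x. f x > 0}.
             ennreal (f (\<theta> * x) powr (r / (r - s)) * f x powr (- (s / (r - s)))) \<partial>lborel)
          (1 - s / r)
      else
        ennreal (\<theta> powr (s + 1)) * ennreal C *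
        (\<integral>\<^sup>+ x\<in>{x. f x > 0}.
           ennreal (f (\<theta> * x) * f x powr (- (s / (1 + r)))) \<partial>lborel))"

end

theory Submission
  imports Defs
begin

text \<open>
  Let \<open>E\<^sub>n\<close> be the minimal \<open>r\<close>-th power error at level \<open>n\<close> for the exponential law of
  rate \<open>l\<close>. Rate optimality is decided by the local spacing of an optimal \<open>\<alpha> n\<close>: around
  \<open>x \<ge> 0\<close> it is of order \<open>exp (l x / (r + 1)) / n\<close>. Since the distance of \<open>x\<close> to \<open>\<theta> \<alpha> n\<close> is
  \<open>\<theta>\<close> times the distance of \<open>x / \<theta>\<close> to \<open>\<alpha> n\<close>, the \<open>s\<close>-th power error of \<open>\<theta> \<alpha> n\<close>, multiplied by
  \<open>n\<^sup>s\<close>, is comparable to the integral of \<open>exp (l s x / (\<theta> (r + 1))) exp (- l x)\<close> over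
  \<open>x \<ge> 0\<close>, and this integral is finite exactly when \<open>\<theta> > s / (r + 1)\<close>.

  The spacing is read off from the decrement \<open>E\<^sub>n - E\<^sub>n\<^sub>+\<^sub>1\<close>, which is of exact order \<open>n\<close> to
  the power \<open>- (r + 1)\<close> (\<open>err_drop_lower\<close>, \<open>err_drop_upper\<close>). Suppose that \<open>x\<close> has distance \<open>d\<close> to
  \<open>\<alpha> n\<close>. Adding \<open>x\<close> to \<open>\<alpha> n\<close> lowers the error by at least a multiple of \<open>exp (- l x)\<close> times
  \<open>d\<close> to the power \<open>r + 1\<close> (up to boundary effects at \<open>0\<close>), and by optimality not by more than
  the decrement; this bounds \<open>d\<close> from above and yields rate optimality for \<open>\<theta> > s / (r + 1)\<close>.
  Conversely, if an interval \<open>[u, u + L]\<close> contains three points of \<open>\<alpha> (n + 1)\<close>, deleting the middle one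
  raises the error by at most \<open>l exp (- l u)\<close> times \<open>L\<close> to the power \<open>r + 1\<close>, and this has to be at
  least the decrement. So short intervals contain at most two points, and intervals with few points
  carry a large error. For \<open>\<theta> \<le> s / (r + 1)\<close> every block \<open>[\<theta> k, \<theta> (k + 1)]\<close> then contributes at
  least a fixed multiple of \<open>n\<^sup>-\<^sup>s\<close> to the \<open>s\<close>-th power error once \<open>n\<close> is large, and summing over many blocks
  destroys rate optimality.

  The decrement is controlled by the lack of memory of the law. Placing a point at \<open>0\<close> and an optimal
  \<open>n\<close>-quantizer, translated by \<open>t\<close>, behind it bounds \<open>E\<^sub>n\<^sub>+\<^sub>1\<close> from above by
  \<open>l t\<^sup>r t + exp (- l t) E\<^sub>n\<close> (\<open>err_Suc_le\<close>). Conversely, with \<open>t\<close> the midpoint of the two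
  leftmost points of \<open>\<alpha> (n + 1)\<close>, the part behind \<open>t\<close> is a translated \<open>n\<close>-quantizer, so that
  \<open>E\<^sub>n\<^sub>+\<^sub>1\<close> is at least \<open>exp (- l t) E\<^sub>n\<close> plus the error that a single point makes on \<open>[0, t]\<close>
  (\<open>first_cell\<close>).

  The minimizers come from explicit integration: on the given range of \<open>\<theta>\<close> the functional is a
  positive constant times \<open>\<theta>\<close> to the power \<open>s + 1\<close> times \<open>\<theta> - c\<close> to the power \<open>- q\<close>, with
  \<open>c = s / (r + 1)\<close> and \<open>q = 1\<close> if \<open>s > r\<close>, and with \<open>c = s / r\<close> and \<open>q = 1 - s / r\<close> if \<open>s < r\<close>. In both
  cases the only minimizer is \<open>(s + 1) c / (s + 1 - q) = (s + 1) / (r + 1)\<close>.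
\<close>

section \<open>The distance to a finite set\<close>

lemma quant_dist_le: "finite A \<Longrightarrow> a \<in> A \<Longrightarrow> quant_dist x A \<le> \<bar>x - a\<bar>"
  unfolding quant_dist_def by (intro Min_le) auto

lemma quant_dist_attained:
  assumes "finite A" "A \<noteq> {}"
  obtains a where "a \<in> A" "quant_dist x A = \<bar>x - a\<bar>"
proof -
  have "Min ((\<lambda>a. \<bar>x - a\<bar>) ` A) \<in> (\<lambda>a. \<bar>x - a\<bar>) ` A"
    using assms by (intro Min_in) auto
  then show ?thesis using that unfolding quant_dist_def by auto
qed

lemma quant_dist_nonneg: "finite A \<Longrightarrow> A \<noteq> {} \<Longrightarrow> 0 \<le> quant_dist x A"
  by (metis abs_ge_zero quant_dist_attained)

lemma quant_dist_lipschitz: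
  assumes "finite A" "A \<noteq> {}"
  shows "quant_dist x A \<le> quant_dist y A + \<bar>x - y\<bar>"
proof -
  obtain a where "a \<in> A" "quant_dist y A = \<bar>y - a\<bar>" using assms by (rule quant_dist_attained)
  moreover have "quant_dist x A \<le> \<bar>x - a\<bar>" using assms calculation by (simp add: quant_dist_le)
  ultimately show ?thesis by linarith
qed

lemma quant_dist_measurable:
  assumes "finite A" "A \<noteq> {}"
  shows "(\<lambda>x. quant_dist x A) \<in> borel_measurable borel"
proof (intro borel_measurable_continuous_onI)
  have "1-lipschitz_on UNIV (\<lambda>x. quant_dist x A)"
  proof (rule lipschitz_onI)
    fix x y :: real
    show "dist (quant_dist x A) (quant_dist y A) \<le> 1 * dist x y"
      using quant_dist_lipschitz[OF assms, of x y] quant_dist_lipschitz[OF assms, of y x]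
      by (auto simp: dist_real_def)
  qed simp
  then show "continuous_on UNIV (\<lambda>x. quant_dist x A)" by (rule lipschitz_on_continuous_on)
qed

lemma quant_dist_antimono:
  "finite A \<Longrightarrow> B \<subseteq> A \<Longrightarrow> B \<noteq> {} \<Longrightarrow> quant_dist x A \<le> quant_dist x B"
  unfolding quant_dist_def by (intro Min_antimono) auto

lemma quant_dist_translate: "quant_dist x ((\<lambda>a. a + t) ` A) = quant_dist (x - t) A"
  unfolding quant_dist_def image_image by (simp add: algebra_simps)

lemma quant_dist_scale:
  assumes "finite A" "A \<noteq> {}" "\<theta> > 0"
  shows "quant_dist x ((\<lambda>a. \<theta> * a) ` A) = \<theta> * quant_dist (x / \<theta>) A"
proof -
  have "\<bar>x - \<theta> * a\<bar> = \<theta> * \<bar>x / \<theta> - a\<bar>" for a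
  proof -
    have "x - \<theta> * a = \<theta> * (x / \<theta> - a)" using \<open>\<theta> > 0\<close> by (simp add: right_diff_distrib)
    then show ?thesis using \<open>\<theta> > 0\<close> by (simp only: abs_mult abs_of_pos)
  qed
  then have "quant_dist x ((\<lambda>a. \<theta> * a) ` A) = Min ((\<lambda>d. \<theta> * d) ` (\<lambda>a. \<bar>x / \<theta> - a\<bar>) ` A)"
    unfolding quant_dist_def image_image by simp
  also have "\<dots> = \<theta> * quant_dist (x / \<theta>) A"
    unfolding quant_dist_def using assms
    by (intro mono_Min_commute[symmetric]) (auto intro!: monoI)
  finally show ?thesis .
qed

section \<open>Few points in an interval force a large error\<close>

text \<open>
  With \<open>\<delta> = L / (4 (M + 1))\<close>, the points of the interval within distance \<open>\<delta>\<close> of one of the at most \<open>M\<close>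
  points inside, or of one of the two ends (which takes care of the points of \<open>A\<close> outside), have total
  length at most \<open>2 M \<delta> + 2 \<delta> = L / 2\<close>. On the other half of the interval the distance to \<open>A\<close> is at
  least \<open>\<delta>\<close>.
\<close>

lemma interval_distortion_ge:
  fixes u L p :: real
  assumes A: "finite A" "A \<noteq> {}" and "L > 0" "p > 0" and M: "card (A \<inter> {u..u + L}) \<le> M"
  shows "ennreal (L / 2 * (L / (4 * (real M + 1))) powr p)
           \<le> (\<integral>\<^sup>+x\<in>{u..<u + L}. ennreal (quant_dist x A powr p) \<partial>lborel)"
proof -
  define \<delta> where "\<delta> = L / (4 * (real M + 1))"
  have \<delta>: "\<delta> > 0" using \<open>L > 0\<close> by (simp add: \<delta>_def)
  let ?I = "{u..<u + L}"
  define N where "N = (\<Union>a\<in>A \<inter> {u..u + L}. {a - \<delta>..a + \<delta>})"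
  define B where "B = N \<union> {u..u + \<delta>} \<union> {u + L - \<delta>..u + L}"
  have fin: "finite (A \<inter> {u..u + L})" using A by simp
  have N: "N \<in> fmeasurable lborel"
    unfolding N_def by (rule fmeasurable.finite_UN[OF fin]) (auto intro!: fmeasurableI simp: emeasure_lborel_Icc_eq)
  have B: "B \<in> fmeasurable lborel" unfolding B_def
    by (intro fmeasurable.Un N) (auto intro!: fmeasurableI simp: emeasure_lborel_Icc_eq)
  have far: "\<delta> \<le> quant_dist x A" if "x \<in> ?I - B" for x
  proof -
    obtain a where a: "a \<in> A" "quant_dist x A = \<bar>x - a\<bar>" using A by (rule quant_dist_attained)
    show ?thesis
    proof (cases "a \<in> {u..u + L}")
      case True
      then have "x \<notin> {a - \<delta>..a + \<delta>}" using that a(1) by (auto simp: B_def N_def)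
      then show ?thesis using a(2) by auto
    next
      case False
      then show ?thesis using that a(2) by (auto simp: B_def)
    qed
  qed
  have "measure lborel N \<le> (\<Sum>a\<in>A \<inter> {u..u + L}. measure lborel {a - \<delta>..a + \<delta>})"
    unfolding N_def by (rule measure_UNION_le[OF fin]) auto
  also have "\<dots> = real (card (A \<inter> {u..u + L})) * (2 * \<delta>)" using \<delta> by simp
  also have "\<dots> \<le> real M * (2 * \<delta>)" using M \<delta> by (intro mult_right_mono) auto
  finally have mN: "measure lborel N \<le> real M * (2 * \<delta>)" .
  have "measure lborel B \<le> measure lborel (N \<union> {u..u + \<delta>}) + measure lborel {u + L - \<delta>..u + L}"
    unfolding B_def using N by (intro measure_Un_le) (auto simp: fmeasurable_def)
  also have "measure lborel (N \<union> {u..u + \<delta>}) \<le> measure lborel N + measure lborel {u..u + \<delta>}"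
    using N by (intro measure_Un_le) (auto simp: fmeasurable_def)
  finally have "measure lborel B \<le> real M * (2 * \<delta>) + 2 * \<delta>" using mN \<delta> by simp
  also have "\<dots> = \<delta> * (4 * (real M + 1)) / 2" by (simp add: algebra_simps)
  also have "\<dots> = L / 2" unfolding \<delta>_def by simp
  finally have mB: "measure lborel B \<le> L / 2" .
  have I: "?I \<in> fmeasurable lborel" using \<open>L > 0\<close> by (intro fmeasurableI) auto
  have D: "?I - B \<in> fmeasurable lborel" using B I by (auto intro!: fmeasurable.Diff)
  have "L = measure lborel ?I" using \<open>L > 0\<close> by simp
  also have "\<dots> \<le> measure lborel ((?I - B) \<union> B)"
    by (intro measure_mono_fmeasurable fmeasurable.Un D B) auto
  also have "\<dots> \<le> measure lborel (?I - B) + measure lborel B"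
    using D B by (intro measure_Un_le) (auto simp: fmeasurable_def)
  finally have "L / 2 \<le> measure lborel (?I - B)" using mB by simp
  then have "ennreal (L / 2 * \<delta> powr p) \<le> ennreal (\<delta> powr p * measure lborel (?I - B))"
    using mult_left_mono[of "L / 2" "measure lborel (?I - B)" "\<delta> powr p"]
    by (intro ennreal_leI) (simp add: mult.commute)
  also have "\<dots> = ennreal (\<delta> powr p) * emeasure lborel (?I - B)"
    using D by (simp add: ennreal_mult fmeasurableD2 emeasure_eq_ennreal_measure)
  also have "\<dots> = (\<integral>\<^sup>+x. ennreal (\<delta> powr p) * indicator (?I - B) x \<partial>lborel)"
    using D by (subst nn_integral_cmult_indicator) (auto simp: fmeasurable_def)
  also have "\<dots> \<le> (\<integral>\<^sup>+x\<in>?I. ennreal (quant_dist x A powr p) \<partial>lborel)"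
    using far \<delta> \<open>p > 0\<close>
    by (intro nn_integral_mono) (auto simp: indicator_def intro!: ennreal_leI powr_mono2)
  finally show ?thesis unfolding \<delta>_def .
qed

section \<open>The exponential law\<close>

lemma nn_integral_exp_decay:
  assumes "c > 0"
  shows "(\<integral>\<^sup>+x\<in>{0..}. ennreal (exp (- (c * x))) \<partial>lborel) = ennreal (1 / c)"
proof -
  have "(\<integral>\<^sup>+x. ennreal (exp (- (c * x))) * indicator {0..} x \<partial>lborel)
          = ennreal (0 - (- exp (- (c * 0)) / c))"
  proof (rule nn_integral_FTC_atLeast[where F = "\<lambda>x. - exp (- (c * x)) / c"])
    show "((\<lambda>x. - exp (- (c * x)) / c) \<longlongrightarrow> 0) at_top"
      using assms by real_asymp
  qed (use assms in \<open>auto intro!: derivative_eq_intros\<close>)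
  then show ?thesis by simp
qed

lemma nn_integral_scaled_exp_decay:
  assumes "K \<ge> 0" "c > 0"
    and "\<And>x. x \<ge> 0 \<Longrightarrow> g x = K * exp (- (c * x))"
  shows "(\<integral>\<^sup>+x\<in>{0..}. ennreal (g x) \<partial>lborel) = ennreal (K / c)"
proof -
  have "(\<integral>\<^sup>+x\<in>{0..}. ennreal (g x) \<partial>lborel)
      = (\<integral>\<^sup>+x. ennreal K * (ennreal (exp (- (c * x))) * indicator {0..} x) \<partial>lborel)"
    using assms by (intro nn_integral_cong) (auto simp: indicator_def ennreal_mult)
  also have "\<dots> = ennreal K * ennreal (1 / c)"
    using assms(2) by (subst nn_integral_cmult) (auto simp: nn_integral_exp_decay)
  also have "\<dots> = ennreal (K / c)" using assms by (simp add: ennreal_mult[symmetric])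
  finally show ?thesis .
qed

abbreviation exp_law :: "real \<Rightarrow> real measure" where
  "exp_law l \<equiv> density lborel (\<lambda>x. ennreal (exponential_density l x))"

text \<open>
  On \<open>x \<ge> 0\<close> this is the Lebesgue density of the error that \<open>A\<close> makes under the exponential law. The
  restriction to \<open>x \<ge> 0\<close> is left to the domain of integration, so that one formula can be translated
  and cut freely.
\<close>

definition cost_density :: "real \<Rightarrow> real \<Rightarrow> real set \<Rightarrow> real \<Rightarrow> real" where
  "cost_density l p A x = l * exp (- (l * x)) * quant_dist x A powr p"

lemma cost_density_measurable:
  "finite A \<Longrightarrow> A \<noteq> {} \<Longrightarrow> cost_density l p A \<in> borel_measurable borel"
  using quant_dist_measurable[of A] unfolding cost_density_def[abs_def] by measurable

lemma cost_density_nonneg: "l > 0 \<Longrightarrow> 0 \<le> cost_density l p A x"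
  by (simp add: cost_density_def)

lemma distortion_exp_law:
  assumes "finite A" "A \<noteq> {}" "l > 0"
  shows "distortion p (exp_law l) A = (\<integral>\<^sup>+x\<in>{0..}. ennreal (cost_density l p A x) \<partial>lborel)"
proof -
  have [measurable]: "(\<lambda>x. quant_dist x A) \<in> borel_measurable borel"
    using assms by (intro quant_dist_measurable)
  have "distortion p (exp_law l) A
      = (\<integral>\<^sup>+x. ennreal (exponential_density l x) * ennreal (quant_dist x A powr p) \<partial>lborel)"
    unfolding distortion_def by (subst nn_integral_density) auto
  also have "\<dots> = (\<integral>\<^sup>+x\<in>{0..}. ennreal (cost_density l p A x) \<partial>lborel)"
    using \<open>l > 0\<close>
    by (intro nn_integral_cong)
       (auto simp: cost_density_def exponential_density_def indicator_def ennreal_mult' mult.commute)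
  finally show ?thesis .
qed

lemma distortion_exp_law_split:
  assumes "finite A" "A \<noteq> {}" "l > 0" "t \<ge> 0"
  shows "distortion p (exp_law l) A
      = (\<integral>\<^sup>+x\<in>{0..<t}. ennreal (cost_density l p A x) \<partial>lborel)
        + (\<integral>\<^sup>+x\<in>{t..}. ennreal (cost_density l p A x) \<partial>lborel)"
proof -
  have [measurable]: "cost_density l p A \<in> borel_measurable borel"
    using assms(1,2) by (rule cost_density_measurable)
  have "{0..} = {0..<t} \<union> {t..}" using \<open>t \<ge> 0\<close> by auto
  then show ?thesis
    unfolding distortion_exp_law[OF assms(1-3)]
    using assms by (simp only:) (intro nn_integral_disjoint_pair; auto)
qed

text \<open>
  Behind \<open>t\<close> the exponential law is a copy of itself, translated by \<open>t\<close> and of total mass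
  \<open>exp (- l t)\<close>.
\<close>

lemma cost_density_tail_memoryless:
  assumes "finite B" "B \<noteq> {}" "l > 0"
  shows "(\<integral>\<^sup>+x\<in>{t..}. ennreal (cost_density l p ((\<lambda>b. b + t) ` B) x) \<partial>lborel)
           = ennreal (exp (- (l * t))) * distortion p (exp_law l) B"
proof -
  let ?A = "(\<lambda>b. b + t) ` B"
  have shift: "cost_density l p ?A (t + x) = exp (- (l * t)) * cost_density l p B x" for x
    by (simp add: cost_density_def quant_dist_translate distrib_left mult_ac flip: exp_add)
  have [measurable]: "cost_density l p ?A \<in> borel_measurable borel"
    "cost_density l p B \<in> borel_measurable borel"
    using assms by (auto intro!: cost_density_measurable)
  have "(\<integral>\<^sup>+x\<in>{t..}. ennreal (cost_density l p ?A x) \<partial>lborel)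
      = (\<integral>\<^sup>+x. ennreal (cost_density l p ?A (t + x)) * indicator {t..} (t + x) \<partial>lborel)"
    by (subst nn_integral_real_affine[where c = 1 and t = t]) auto
  also have "\<dots> = (\<integral>\<^sup>+x. ennreal (exp (- (l * t))) *
                    (ennreal (cost_density l p B x) * indicator {0..} x) \<partial>lborel)"
    unfolding shift by (intro nn_integral_cong) (auto simp: indicator_def ennreal_mult')
  also have "\<dots> = ennreal (exp (- (l * t))) * distortion p (exp_law l) B"
    unfolding distortion_exp_law[OF assms] by (rule nn_integral_cmult) auto
  finally show ?thesis .
qed

lemma distortion_exp_law_interval_ge:
  assumes A: "finite A" "A \<noteq> {}" and "l > 0" "L > 0" "p > 0"
    and M: "card (A \<inter> {u..u + L}) \<le> M"
  shows "ennreal (l * exp (- (l * (u + L))) * (L / 2 * (L / (4 * (real M + 1))) powr p))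
           \<le> (\<integral>\<^sup>+x\<in>{u..<u + L}. ennreal (cost_density l p A x) \<partial>lborel)"
proof -
  have [measurable]: "(\<lambda>x. quant_dist x A) \<in> borel_measurable borel"
    using A by (rule quant_dist_measurable)
  let ?c = "l * exp (- (l * (u + L)))"
  have "ennreal (?c * (L / 2 * (L / (4 * (real M + 1))) powr p))
      \<le> ennreal ?c * (\<integral>\<^sup>+x\<in>{u..<u + L}. ennreal (quant_dist x A powr p) \<partial>lborel)"
    using interval_distortion_ge[OF A \<open>L > 0\<close> \<open>p > 0\<close> M] \<open>l > 0\<close>
    by (subst ennreal_mult') (auto intro!: mult_left_mono)
  also have "\<dots> = (\<integral>\<^sup>+x. ennreal ?c * (ennreal (quant_dist x A powr p) * indicator {u..<u + L} x) \<partial>lborel)"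
    by (rule nn_integral_cmult[symmetric]) auto
  also have "\<dots> \<le> (\<integral>\<^sup>+x\<in>{u..<u + L}. ennreal (cost_density l p A x) \<partial>lborel)"
  proof (rule nn_integral_mono)
    fix x
    show "ennreal ?c * (ennreal (quant_dist x A powr p) * indicator {u..<u + L} x)
        \<le> ennreal (cost_density l p A x) * indicator {u..<u + L} x"
      using \<open>l > 0\<close> unfolding cost_density_def
      by (auto simp: indicator_def ennreal_mult'[symmetric] intro!: ennreal_leI mult_right_mono)
  qed
  finally show ?thesis .
qed

text \<open>
  The inequality \<open>y \<le> exp y\<close> at \<open>y = l x / (2 p)\<close> bounds \<open>x\<close> to the power \<open>p\<close> by a multiple of
  \<open>exp (l x / 2)\<close>, half of the decay rate of the law.
\<close>

lemma distortion_exp_law_origin_finite: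
  assumes "l > 0" "p > 0"
  shows "distortion p (exp_law l) {0} < \<infinity>"
proof -
  have powr_le: "x powr p \<le> (2 * p / l) powr p * exp (l / 2 * x)" if "x \<ge> 0" for x
  proof -
    have "x = (2 * p / l) * (l / (2 * p) * x)" using assms by simp
    also have "\<dots> \<le> (2 * p / l) * exp (l / (2 * p) * x)"
    proof (rule mult_left_mono)
      show "l / (2 * p) * x \<le> exp (l / (2 * p) * x)"
        using exp_ge_add_one_self[of "l / (2 * p) * x"] by linarith
    qed (use assms in simp)
    finally have "x powr p \<le> ((2 * p / l) * exp (l / (2 * p) * x)) powr p"
      using that assms by (intro powr_mono2) auto
    also have "\<dots> = (2 * p / l) powr p * exp (l / 2 * x)"
      using assms by (subst powr_mult) (auto simp: exp_powr_real)
    finally show ?thesis .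
  qed
  have "distortion p (exp_law l) {0}
      \<le> (\<integral>\<^sup>+x. ennreal (l * (2 * p / l) powr p) * (ennreal (exp (- (l / 2 * x))) * indicator {0..} x) \<partial>lborel)"
    unfolding distortion_exp_law[OF finite.insertI[OF finite.emptyI] insert_not_empty \<open>l > 0\<close>]
  proof (rule nn_integral_mono)
    fix x
    have "l * exp (- (l * x)) * \<bar>x\<bar> powr p \<le> l * (2 * p / l) powr p * exp (- (l / 2 * x))" if "x \<ge> 0"
    proof -
      have "l * exp (- (l * x)) * \<bar>x\<bar> powr p
          \<le> l * exp (- (l * x)) * ((2 * p / l) powr p * exp (l / 2 * x))"
        using powr_le[OF that] that assms by (intro mult_left_mono) auto
      also have "\<dots> = l * (2 * p / l) powr p * (exp (- (l * x)) * exp (l / 2 * x))" by simp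
      also have "exp (- (l * x)) * exp (l / 2 * x) = exp (- (l / 2 * x))"
        by (simp flip: exp_add)
      finally show ?thesis .
    qed
    then show "ennreal (cost_density l p {0} x) * indicator {0..} x
        \<le> ennreal (l * (2 * p / l) powr p) * (ennreal (exp (- (l / 2 * x))) * indicator {0..} x)"
      using assms
      by (auto simp: indicator_def cost_density_def quant_dist_def ennreal_mult'[symmetric]
          intro!: ennreal_leI)
  qed
  also have "\<dots> = ennreal (l * (2 * p / l) powr p) * ennreal (1 / (l / 2))"
    using assms nn_integral_exp_decay[of "l / 2"] by (subst nn_integral_cmult) auto
  also have "\<dots> < \<infinity>" by (simp add: ennreal_mult_less_top)
  finally show ?thesis .
qed

section \<open>The optimal error and its decrements\<close>

lemma powr_le_powr_imp_le:
  fixes x y :: real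
  assumes "q > 0" "0 \<le> y" "x powr q \<le> y powr q"
  shows "x \<le> y"
  using assms powr_less_mono2[of q y x] by (meson not_less)

lemma ex_between_of_card_ge_3:
  fixes S :: "real set"
  assumes "3 \<le> card S"
  obtains p q q' where "p \<in> S" "q \<in> S" "q' \<in> S" "p < q" "q < q'"
proof -
  have fin: "finite S" using assms by (intro card_ge_0_finite) simp
  have ne: "S \<noteq> {}" using assms by auto
  have "card {Min S, Max S} \<le> 2" by (simp add: card_insert_if)
  then have "\<not> S \<subseteq> {Min S, Max S}"
    using assms card_mono[of "{Min S, Max S}" S] by auto
  then obtain q where q: "q \<in> S" "q \<noteq> Min S" "q \<noteq> Max S" by auto
  show thesis
    using q Min_le[OF fin q(1)] Max_ge[OF fin q(1)] Min_in[OF fin ne] Max_in[OF fin ne]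
    by (intro that[of "Min S" q "Max S"]) (simp_all only: less_le, auto)
qed

locale optimal_for_exp_law =
  fixes l r :: real and \<alpha> :: "nat \<Rightarrow> real set"
  assumes l: "l > 0" and r: "r > 0"
    and optimal: "optimal_quantizers r (exp_law l) \<alpha>"
begin

definition err :: "nat \<Rightarrow> real" where
  "err n = enn2real (distortion r (exp_law l) (\<alpha> n))"

lemma optimal_finite: "n \<ge> 1 \<Longrightarrow> finite (\<alpha> n)"
  and optimal_nonempty: "n \<ge> 1 \<Longrightarrow> \<alpha> n \<noteq> {}"
  and optimal_card: "n \<ge> 1 \<Longrightarrow> card (\<alpha> n) \<le> n"
  using optimal by (auto simp: optimal_quantizers_def quantizer_def)

lemma optimal_le:
  assumes "n \<ge> 1" "quantizer n B"
  shows "distortion r (exp_law l) (\<alpha> n) \<le> distortion r (exp_law l) B"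
proof -
  have "distortion r (exp_law l) (\<alpha> n) = min_distortion r n (exp_law l)"
    using optimal assms by (auto simp: optimal_quantizers_def)
  also have "\<dots> \<le> distortion r (exp_law l) B"
    unfolding min_distortion_def using assms by (intro INF_lower) auto
  finally show ?thesis .
qed

lemma err_eq: "n \<ge> 1 \<Longrightarrow> ennreal (err n) = distortion r (exp_law l) (\<alpha> n)"
proof -
  assume n: "n \<ge> 1"
  then have "distortion r (exp_law l) (\<alpha> n) \<le> distortion r (exp_law l) {0}"
    by (intro optimal_le) (auto simp: quantizer_def)
  also have "\<dots> < \<infinity>" using l r by (rule distortion_exp_law_origin_finite)
  finally show ?thesis by (simp add: err_def)
qed

lemma err_nonneg: "0 \<le> err n" by (simp add: err_def)

lemma err_le:
  assumes "n \<ge> 1" "quantizer n B" "distortion r (exp_law l) B \<le> ennreal c" "0 \<le> c"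
  shows "err n \<le> c"
  using order_trans[OF optimal_le[OF assms(1,2)] assms(3)] err_eq[OF assms(1)] assms(4)
  by (metis ennreal_le_iff)

text \<open>
  A point at \<open>0\<close> serves \<open>[0, t)\<close>, and an optimal \<open>n\<close>-quantizer translated by \<open>t\<close> serves the rest.
\<close>

lemma err_Suc_le:
  assumes "n \<ge> 1" "t \<ge> 0"
  shows "err (Suc n) \<le> l * t powr r * t + exp (- (l * t)) * err n"
proof (rule err_le)
  note fin = optimal_finite[OF assms(1)] and ne = optimal_nonempty[OF assms(1)]
  let ?B = "(\<lambda>a. a + t) ` \<alpha> n"
  let ?A = "insert 0 ?B"
  have A: "finite ?A" "?A \<noteq> {}" using fin by auto
  have "card ?A \<le> Suc (card ?B)" by (rule card_insert_le_m1) auto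
  also have "card ?B \<le> n" using card_image_le[OF fin] optimal_card[OF assms(1)] by (rule order_trans)
  finally show "quantizer (Suc n) ?A" using A by (auto simp: quantizer_def)
  have "(\<integral>\<^sup>+x\<in>{0..<t}. ennreal (cost_density l r ?A x) \<partial>lborel)
      \<le> (\<integral>\<^sup>+x. ennreal (l * t powr r) * indicator {0..<t} x \<partial>lborel)"
  proof (rule nn_integral_mono)
    fix x
    have "cost_density l r ?A x \<le> l * t powr r" if "x \<in> {0..<t}"
    proof -
      have "quant_dist x ?A powr r \<le> t powr r"
        using that r quant_dist_le[OF A(1), of 0 x] quant_dist_nonneg[OF A, of x]
        by (intro powr_mono2) auto
      moreover have "l * exp (- (l * x)) \<le> l * 1" using l that by (intro mult_left_mono) auto
      ultimately show ?thesis unfolding cost_density_def using l by (intro mult_mono) auto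
    qed
    then show "ennreal (cost_density l r ?A x) * indicator {0..<t} x
        \<le> ennreal (l * t powr r) * indicator {0..<t} x"
      by (auto simp: indicator_def intro!: ennreal_leI)
  qed
  also have "\<dots> = ennreal (l * t powr r * t)"
    using l assms by (subst nn_integral_cmult_indicator) (auto simp: ennreal_mult'')
  finally have head: "(\<integral>\<^sup>+x\<in>{0..<t}. ennreal (cost_density l r ?A x) \<partial>lborel)
      \<le> ennreal (l * t powr r * t)" .
  have "(\<integral>\<^sup>+x\<in>{t..}. ennreal (cost_density l r ?A x) \<partial>lborel)
      \<le> (\<integral>\<^sup>+x\<in>{t..}. ennreal (cost_density l r ?B x) \<partial>lborel)"
    unfolding cost_density_def using l r fin ne
    by (intro nn_integral_mono mult_right_mono ennreal_leI mult_left_mono powr_mono2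
        quant_dist_antimono quant_dist_nonneg) auto
  also have "\<dots> = ennreal (exp (- (l * t)) * err n)"
    using cost_density_tail_memoryless[OF fin ne l] err_eq[OF assms(1)] by (simp add: ennreal_mult')
  finally have tail: "(\<integral>\<^sup>+x\<in>{t..}. ennreal (cost_density l r ?A x) \<partial>lborel)
      \<le> ennreal (exp (- (l * t)) * err n)" .
  show "distortion r (exp_law l) ?A \<le> ennreal (l * t powr r * t + exp (- (l * t)) * err n)"
    unfolding distortion_exp_law_split[OF A l \<open>t \<ge> 0\<close>]
    using add_mono[OF head tail] l assms err_nonneg by (simp add: ennreal_plus)
  show "0 \<le> l * t powr r * t + exp (- (l * t)) * err n" using l assms err_nonneg by simp
qed simp

text \<open>
  The cut point \<open>t\<close> with \<open>exp (- l t)\<close> equal to \<open>n / (n + 1)\<close> to the power \<open>r + 1\<close> turns \<open>err_Suc_le\<close>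
  into the statement that \<open>err n\<close>, multiplied by \<open>n\<close> to the power \<open>r + 1\<close>, grows by at most a constant
  in each step, hence at most linearly. The exponent \<open>r + 1\<close> is the one for which the contribution of
  the first cell, which is of order \<open>t\<close> to the power \<open>r + 1\<close>, becomes bounded.
\<close>

lemma err_upper: "\<exists>K>0. \<forall>n\<ge>1. err n \<le> K * real n powr - r"
proof -
  define D where "D = l * ((r + 1) / l) powr r * ((r + 1) / l)"
  have D: "D > 0" using l r by (simp add: D_def)
  define K where "K = D * 2 powr (r + 1) + err 1"
  have K: "K > 0" unfolding K_def using D err_nonneg[of 1] by (intro add_pos_nonneg mult_pos_pos) auto
  have growth: "real (Suc n) powr (r + 1) * err (Suc n) \<le> real n powr (r + 1) * err n + K"
    if n: "n \<ge> 1" for n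
  proof -
    define q where "q = real (Suc n) / real n"
    have q: "q > 1" "q = 1 + 1 / real n" using n by (auto simp: q_def field_simps)
    define t where "t = (r + 1) / l * ln q"
    have t0: "t \<ge> 0" using l r q(1) by (simp add: t_def)
    have "ln q \<le> 1 / real n" unfolding q(2) by (rule ln_add_one_self_le_self) simp
    then have t1: "t \<le> (r + 1) / l * (1 / real n)"
      unfolding t_def using l r by (intro mult_left_mono) auto
    have ex: "exp (- (l * t)) = (real n / real (Suc n)) powr (r + 1)"
    proof -
      have "l * t = (r + 1) * ln q" using l by (simp add: t_def)
      then show ?thesis using n by (simp add: q_def powr_def ln_div algebra_simps)
    qed
    have "err (Suc n) \<le> l * t powr r * t + exp (- (l * t)) * err n"
      by (rule err_Suc_le[OF n t0])
    also have "l * t powr r * t \<le> l * ((r + 1) / l * (1 / real n)) powr r * ((r + 1) / l * (1 / real n))"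
      using l r t0 t1 by (intro mult_mono powr_mono2) auto
    also have "\<dots> = D * (1 / real n) powr (r + 1)"
      using l r n unfolding D_def by (subst powr_mult) (auto simp: powr_add)
    finally have "real (Suc n) powr (r + 1) * err (Suc n)
        \<le> real (Suc n) powr (r + 1) * (D * (1 / real n) powr (r + 1)
            + (real n / real (Suc n)) powr (r + 1) * err n)"
      unfolding ex by (intro mult_left_mono) auto
    also have "\<dots> = D * q powr (r + 1) + real n powr (r + 1) * err n"
      using n by (simp add: q_def powr_divide distrib_left)
    also have "D * q powr (r + 1)
        \<le> D * 2 powr (r + 1)"
      using D r q n by (intro mult_left_mono powr_mono2) auto
    also have "\<dots> \<le> K" using err_nonneg[of 1] by (simp add: K_def)
    finally show ?thesis by simp
  qed
  have "real n powr (r + 1) * err n \<le> K * real n" if "n \<ge> 1" for n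
    using that
  proof (induction n rule: dec_induct)
    case base
    show ?case unfolding K_def using D by simp
  next
    case (step n)
    then show ?case using growth[of n] by (simp add: algebra_simps)
  qed
  then have "err n \<le> K * real n powr - r" if "n \<ge> 1" for n
    using that by (simp add: powr_add powr_minus field_simps)
  then show ?thesis using K by blast
qed

text \<open>
  The at most \<open>n\<close> points already leave an error of this order on \<open>[0, 1]\<close>.
\<close>

lemma err_lower: "\<exists>k>0. \<forall>n\<ge>1. k * real n powr - r \<le> err n"
proof (intro exI conjI allI impI)
  let ?k = "l * exp (- l) * (1 / 2 * (1 / 8) powr r)"
  show "?k > 0" using l by simp
  fix n :: nat assume n: "n \<ge> 1"
  note fin = optimal_finite[OF n] and ne = optimal_nonempty[OF n]
  have "card (\<alpha> n \<inter> {0..0 + 1}) \<le> card (\<alpha> n)" using fin by (intro card_mono) auto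
  then have card: "card (\<alpha> n \<inter> {0..0 + 1}) \<le> n" using optimal_card[OF n] by simp
  have "1 / (8 * real n) \<le> 1 / (4 * (real n + 1))" using n by (simp add: field_simps)
  then have "(1 / (8 * real n)) powr r \<le> (1 / (4 * (real n + 1))) powr r"
    using r n by (intro powr_mono2) auto
  then have "?k * real n powr - r \<le> l * exp (- (l * (0 + 1))) * (1 / 2 * (1 / (4 * (real n + 1))) powr r)"
    using l n by (simp add: powr_minus powr_divide powr_mult field_simps)
  also have "ennreal \<dots> \<le> (\<integral>\<^sup>+x\<in>{0..<0 + 1}. ennreal (cost_density l r (\<alpha> n) x) \<partial>lborel)"
    by (rule distortion_exp_law_interval_ge[OF fin ne l _ r card]) simp
  also have "\<dots> \<le> distortion r (exp_law l) (\<alpha> n)"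
    by (subst distortion_exp_law_split[OF fin ne l, of "0 + 1"]) auto
  finally have "ennreal (?k * real n powr - r) \<le> ennreal (err n)"
    using err_eq[OF n] by (simp add: ennreal_leI)
  then show "?k * real n powr - r \<le> err n" using err_nonneg by simp
qed

text \<open>
  By \<open>err_Suc_le\<close> the decrement is at least \<open>(1 - exp (- l t)) err n - l t\<^sup>r t\<close>. At \<open>t = \<epsilon> / n\<close> both
  terms have the order \<open>n\<close> to the power \<open>- (r + 1)\<close>, the first one with a factor \<open>\<epsilon>\<close>, the second one
  with a factor \<open>\<epsilon>\<close> to the power \<open>r + 1\<close>; so the first one wins for small \<open>\<epsilon>\<close>.
\<close>

lemma err_drop_lower: "\<exists>c>0. \<forall>n\<ge>1. c * real n powr - (r + 1) \<le> err n - err (Suc n)"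
proof -
  obtain k where k: "k > 0" "\<And>n. n \<ge> 1 \<Longrightarrow> k * real n powr - r \<le> err n"
    using err_lower by blast
  \<comment> \<open>The first bound gives \<open>l t \<le> 1\<close>, where \<open>1 - exp (- l t)\<close> is at least half of \<open>l t\<close>; the second
    one makes the subtracted term at most half of the main one.\<close>
  define \<epsilon> where "\<epsilon> = min (1 / l) ((k / 4) powr (1 / r))"
  have \<epsilon>: "\<epsilon> > 0" "l * \<epsilon> \<le> 1" using l k by (auto simp: \<epsilon>_def min_def field_simps)
  have "\<epsilon> powr r \<le> ((k / 4) powr (1 / r)) powr r"
    using \<epsilon>(1) r by (intro powr_mono2) (auto simp: \<epsilon>_def)
  also have "\<dots> = k / 4" using k r by (simp add: powr_powr)
  finally have \<epsilon>r: "\<epsilon> powr r \<le> k / 4" .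
  have "(l * \<epsilon> * (k / 4)) * real n powr - (r + 1) \<le> err n - err (Suc n)" if n: "n \<ge> 1" for n
  proof -
    define t where "t = \<epsilon> / real n"
    have t: "t > 0" using \<epsilon> n by (simp add: t_def)
    have "l * t \<le> l * \<epsilon>" using l \<epsilon> n by (simp add: t_def field_simps)
    then have lt: "l * t \<le> 1" using \<epsilon> by simp
    have "exp (- (l * t)) \<le> 1 / (1 + l * t)"
      using exp_ge_add_one_self[of "l * t"] l t
      by (simp add: exp_minus inverse_eq_divide frac_le add_pos_pos)
    also have "\<dots> = 1 - l * t / (1 + l * t)"
    proof -
      have "1 + l * t \<noteq> 0" using l t by (simp add: add_pos_pos less_imp_neq[symmetric])
      then show ?thesis by (simp add: field_simps)
    qed
    also have "\<dots> \<le> 1 - l * t / 2"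
      using l t lt by (intro diff_left_mono divide_left_mono) (auto intro!: mult_pos_pos add_pos_pos)
    finally have ex: "l * t / 2 \<le> 1 - exp (- (l * t))" by simp
    have p1: "real n powr - (r + 1) = real n powr - r / real n"
      using n powr_diff[of "real n" "- r" 1] by simp
    have "(l * \<epsilon> * (k / 4)) * real n powr - (r + 1) = l * t / 2 * (k * real n powr - r) - l * (k / 4 * real n powr - r) * t"
      unfolding p1 t_def by (simp add: field_simps)
    also have "\<dots> \<le> (1 - exp (- (l * t))) * err n - l * t powr r * t"
    proof (rule diff_mono)
      show "l * t / 2 * (k * real n powr - r) \<le> (1 - exp (- (l * t))) * err n"
        using ex k n l t by (intro mult_mono) auto
      have "t powr r = \<epsilon> powr r * real n powr - r"
        using \<epsilon> n by (simp add: t_def powr_divide powr_minus field_simps)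
      also have "\<dots> \<le> k / 4 * real n powr - r" using \<epsilon>r by (intro mult_right_mono) auto
      finally show "l * t powr r * t \<le> l * (k / 4 * real n powr - r) * t"
        using l t by (intro mult_right_mono mult_left_mono) auto
    qed
    also have "\<dots> \<le> err n - err (Suc n)"
      using err_Suc_le[OF n, of t] t by (simp add: algebra_simps)
    finally show ?thesis .
  qed
  moreover have "l * \<epsilon> * (k / 4) > 0" using l \<epsilon> k by simp
  ultimately show ?thesis by blast
qed

lemma err_strict_decreasing:
  assumes "n \<ge> 1"
  shows "err (Suc n) < err n"
proof -
  obtain c where "c > 0" "c * real n powr - (r + 1) \<le> err n - err (Suc n)"
    using err_drop_lower assms by blast
  moreover have "c * real n powr - (r + 1) > 0" using \<open>c > 0\<close> assms by simp
  ultimately show ?thesis by linarith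
qed

text \<open>
  Let \<open>a < b\<close> be the two leftmost points of \<open>\<alpha> (n + 1)\<close> and \<open>t\<close> their midpoint (or \<open>0\<close>, if that is
  negative). Behind \<open>t\<close> the point \<open>a\<close> is of no use, so there the other at most \<open>n\<close> points do all the
  work, and lack of memory compares their error with \<open>err n\<close>. On \<open>[0, t]\<close> only \<open>a\<close> is used, and the
  error of a single point on an interval is bounded from below. The first cell is cut off at \<open>1 / l\<close>,
  which keeps the density on it above \<open>l exp (- 1)\<close>.
\<close>

lemma first_cell:
  assumes n: "n \<ge> 1"
  obtains t where "t \<ge> 0"
    "l * (exp (- 1) * (1 / 2 * (1 / 8) powr r)) * min t (1 / l) powr r * min t (1 / l)
       + exp (- (l * t)) * err n \<le> err (Suc n)"
proof -
  let ?A = "\<alpha> (Suc n)"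
  have fin: "finite ?A" and ne: "?A \<noteq> {}" and card: "card ?A \<le> Suc n"
    using optimal_finite[of "Suc n"] optimal_nonempty[of "Suc n"] optimal_card[of "Suc n"] by auto
  define a where "a = Min ?A"
  have a: "a \<in> ?A" "\<And>x. x \<in> ?A \<Longrightarrow> a \<le> x" using fin ne by (auto simp: a_def)
  define R where "R = ?A - {a}"
  have finR: "finite R" using fin by (simp add: R_def)
  have cR: "card R \<le> n" using card a(1) fin by (simp add: R_def)
  \<comment> \<open>A single point would be an \<open>n\<close>-quantizer as good as the optimum for \<open>n + 1\<close> points.\<close>
  have R_ne: "R \<noteq> {}"
  proof
    assume "R = {}"
    then have "?A = {a}" using a by (auto simp: R_def)
    then have "quantizer n ?A" using n by (simp add: quantizer_def)
    then have "err n \<le> err (Suc n)"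
      using err_le[OF n, of ?A "err (Suc n)"] err_eq[of "Suc n"] err_nonneg by simp
    then show False using err_strict_decreasing[OF n] by simp
  qed
  define b where "b = Min R"
  have b: "b \<in> R" "\<And>x. x \<in> R \<Longrightarrow> b \<le> x" using finR R_ne by (auto simp: b_def)
  have "a < b" using a b(1) by (force simp: R_def)
  define t where "t = max 0 ((a + b) / 2)"
  have t: "t \<ge> 0" by (simp add: t_def)
  define u where "u = min t (1 / l)"
  have u: "u \<ge> 0" "u \<le> t" "l * u \<le> 1" using t l by (auto simp: u_def min_def field_simps)
  have right: "quant_dist x ?A = quant_dist x R" if "x \<ge> t" for x
  proof (rule antisym)
    show "quant_dist x ?A \<le> quant_dist x R"
      using fin R_ne by (intro quant_dist_antimono) (auto simp: R_def)
    obtain y where y: "y \<in> ?A" "quant_dist x ?A = \<bar>x - y\<bar>" using fin ne by (rule quant_dist_attained)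
    show "quant_dist x R \<le> quant_dist x ?A"
    proof (cases "y = a")
      case True
      have "(a + b) / 2 \<le> x" using that by (simp add: t_def)
      then have "\<bar>x - b\<bar> \<le> \<bar>x - a\<bar>" using \<open>a < b\<close> by (simp add: abs_le_iff)
      then show ?thesis using quant_dist_le[OF finR b(1), of x] y(2) True by simp
    next
      case False
      then show ?thesis using quant_dist_le[OF finR, of y x] y by (simp add: R_def)
    qed
  qed
  have left: "quant_dist x ?A = quant_dist x {a}" if "0 \<le> x" "x < t" for x
  proof (rule antisym)
    show "quant_dist x ?A \<le> quant_dist x {a}"
      using fin a by (intro quant_dist_antimono) auto
    obtain y where y: "y \<in> ?A" "quant_dist x ?A = \<bar>x - y\<bar>" using fin ne by (rule quant_dist_attained)
    have "x < (a + b) / 2" using that by (auto simp: t_def max_def split: if_splits)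
    moreover have "y = a \<or> b \<le> y" using y(1) b(2) by (auto simp: R_def)
    ultimately have "\<bar>x - a\<bar> \<le> \<bar>x - y\<bar>" using \<open>a < b\<close> by (auto simp: abs_le_iff)
    then show "quant_dist x {a} \<le> quant_dist x ?A" using y(2) by (simp add: quant_dist_def)
  qed
  let ?S = "(\<lambda>x. x - t) ` R"
  have S: "finite ?S" "?S \<noteq> {}" "quantizer n ?S"
    using finR R_ne cR card_image_le[OF finR, of "\<lambda>x. x - t"] by (auto simp: quantizer_def)
  have "ennreal (exp (- (l * t)) * err n) \<le> ennreal (exp (- (l * t))) * distortion r (exp_law l) ?S"
    using optimal_le[OF n S(3)] err_eq[OF n] by (simp add: ennreal_mult' mult_left_mono)
  also have "\<dots> = (\<integral>\<^sup>+x\<in>{t..}. ennreal (cost_density l r ((\<lambda>b. b + t) ` ?S) x) \<partial>lborel)"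
    using cost_density_tail_memoryless[OF S(1,2) l] by simp
  also have "(\<lambda>b. b + t) ` ?S = R" by (auto simp: image_image)
  also have "(\<integral>\<^sup>+x\<in>{t..}. ennreal (cost_density l r R x) \<partial>lborel)
      = (\<integral>\<^sup>+x\<in>{t..}. ennreal (cost_density l r ?A x) \<partial>lborel)"
    by (intro nn_integral_cong) (auto simp: cost_density_def right indicator_def)
  finally have tail: "ennreal (exp (- (l * t)) * err n)
      \<le> (\<integral>\<^sup>+x\<in>{t..}. ennreal (cost_density l r ?A x) \<partial>lborel)" .
  have head: "ennreal (l * (exp (- 1) * (1 / 2 * (1 / 8) powr r)) * u powr r * u)
      \<le> (\<integral>\<^sup>+x\<in>{0..<t}. ennreal (cost_density l r ?A x) \<partial>lborel)"
  proof (cases "u = 0")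
    case False
    then have u0: "u > 0" using u by simp
    have "card ({a} \<inter> {0..0 + u}) \<le> card {a}" by (intro card_mono) auto
    then have ca: "card ({a} \<inter> {0..0 + u}) \<le> 1" by simp
    have "l * (exp (- 1) * (1 / 2 * (1 / 8) powr r)) * u powr r * u
        = l * exp (- 1) * (u / 2 * (u / (4 * (real 1 + 1))) powr r)"
      using u0 by (simp add: powr_divide)
    also have "\<dots> \<le> l * exp (- (l * (0 + u))) * (u / 2 * (u / (4 * (real 1 + 1))) powr r)"
      using l u u0 by (intro mult_right_mono mult_left_mono) auto
    also have "ennreal \<dots> \<le> (\<integral>\<^sup>+x\<in>{0..<0 + u}. ennreal (cost_density l r {a} x) \<partial>lborel)"
      by (rule distortion_exp_law_interval_ge[OF _ _ l u0 r ca]) auto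
    also have "\<dots> \<le> (\<integral>\<^sup>+x\<in>{0..<t}. ennreal (cost_density l r ?A x) \<partial>lborel)"
      using u by (intro nn_integral_mono) (auto simp: cost_density_def left indicator_def)
    finally show ?thesis by (simp add: ennreal_leI)
  qed simp
  have "ennreal (l * (exp (- 1) * (1 / 2 * (1 / 8) powr r)) * u powr r * u + exp (- (l * t)) * err n)
      \<le> ennreal (err (Suc n))"
    using add_mono[OF head tail] distortion_exp_law_split[OF fin ne l t] err_eq[of "Suc n"] l u err_nonneg
    by (simp add: ennreal_plus)
  then have "l * (exp (- 1) * (1 / 2 * (1 / 8) powr r)) * u powr r * u + exp (- (l * t)) * err n
      \<le> err (Suc n)"
    using err_nonneg by simp
  then show thesis using that[OF t] unfolding u_def by simp
qed

text \<open>
  With \<open>u = min t (1 / l)\<close> one has \<open>1 - exp (- l t) \<le> l u\<close>, so \<open>first_cell\<close> bounds the decrement by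
  \<open>l u err n - \<kappa> l u\<^sup>r u\<close>. Since the decrement is positive, \<open>u\<close> is at most of the order of the \<open>r\<close>-th
  root of \<open>err n\<close>, that is, of order \<open>1 / n\<close>; the decrement is then at most \<open>l u err n\<close>, which is of
  order \<open>n\<close> to the power \<open>- (r + 1)\<close>.
\<close>

lemma err_drop_upper: "\<exists>C>0. \<forall>n\<ge>1. err n - err (Suc n) \<le> C * real n powr - (r + 1)"
proof -
  obtain K where K: "K > 0" "\<And>n. n \<ge> 1 \<Longrightarrow> err n \<le> K * real n powr - r"
    using err_upper by blast
  define \<kappa> where "\<kappa> = exp (- 1) * (1 / 2 * (1 / 8) powr r)"
  have \<kappa>: "\<kappa> > 0" by (simp add: \<kappa>_def)
  have "err n - err (Suc n) \<le> (l * (K / \<kappa>) powr (1 / r) * K) * real n powr - (r + 1)" if n: "n \<ge> 1" for n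
  proof -
    obtain t where t: "t \<ge> 0"
      "l * \<kappa> * min t (1 / l) powr r * min t (1 / l) + exp (- (l * t)) * err n \<le> err (Suc n)"
      using first_cell[OF n, folded \<kappa>_def] by blast
    define u where "u = min t (1 / l)"
    have u0: "u \<ge> 0" using t(1) l by (simp add: u_def)
    have "1 - exp (- (l * t)) \<le> l * u"
    proof -
      have "l * u = min (l * t) 1" using l by (auto simp: u_def min_def field_simps)
      then show ?thesis using exp_ge_add_one_self[of "- (l * t)"] by simp
    qed
    then have "(1 - exp (- (l * t))) * err n \<le> l * u * err n"
      using err_nonneg by (intro mult_right_mono)
    then have drop: "err n - err (Suc n) \<le> l * u * err n - l * \<kappa> * u powr r * u"
      using t(2) unfolding u_def[symmetric] by (simp add: algebra_simps)
    then have drop': "err n - err (Suc n) \<le> l * u * err n"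
    proof -
      have "0 \<le> l * \<kappa> * u powr r * u" using l \<kappa> u0 by simp
      then show ?thesis using drop by linarith
    qed
    have "u \<le> (K / \<kappa>) powr (1 / r) * real n powr - 1"
    proof (cases "u = 0")
      case False
      then have u1: "u > 0" using u0 by simp
      have "0 \<le> l * u * (err n - \<kappa> * u powr r)"
        using drop err_strict_decreasing[OF n] by (simp add: algebra_simps)
      moreover have "0 < l * u" using l u1 by simp
      ultimately have "\<kappa> * u powr r \<le> err n" by (simp only: zero_le_mult_iff) linarith
      also have "\<dots> \<le> K * real n powr - r" by (rule K(2)[OF n])
      finally have "u powr r \<le> K / \<kappa> * real n powr - r" using \<kappa> by (simp add: field_simps)
      then have "(u powr r) powr (1 / r) \<le> (K / \<kappa> * real n powr - r) powr (1 / r)"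
        using r by (intro powr_mono2) auto
      also have "\<dots> = (K / \<kappa>) powr (1 / r) * real n powr - 1"
        using K \<kappa> r n by (subst powr_mult) (auto simp: powr_powr)
      finally show ?thesis using r u1 by (simp add: powr_powr)
    qed simp
    then have "l * u * err n \<le> l * ((K / \<kappa>) powr (1 / r) * real n powr - 1) * (K * real n powr - r)"
      using l u0 K n err_nonneg by (intro mult_mono mult_left_mono) auto
    also have "\<dots> = (l * (K / \<kappa>) powr (1 / r) * K) * (real n powr - 1 * real n powr - r)" by simp
    also have "real n powr - 1 * real n powr - r = real n powr (- 1 + - r)"
      by (simp only: powr_add)
    also have "- 1 + - r = - (r + 1)" by simp
    finally show ?thesis using drop' by linarith
  qed
  moreover have "l * (K / \<kappa>) powr (1 / r) * K > 0" using l K \<kappa> by simp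
  ultimately show ?thesis by blast
qed

section \<open>Adding a point: the scaled quantizers that are rate-optimal\<close>

text \<open>
  If \<open>d\<close> is the distance of \<open>x\<close> to \<open>\<alpha> n\<close>, then a point within \<open>d / 4\<close> of \<open>x\<close> has distance at least
  \<open>3 d / 4\<close> to \<open>\<alpha> n\<close>, but at most \<open>d / 4\<close> to \<open>x\<close>. Adding \<open>x\<close> to \<open>\<alpha> n\<close> therefore gains on every interval
  \<open>[u, v]\<close> of such points.
\<close>

lemma err_drop_ge_local_gain:
  assumes n: "n \<ge> 1" and uv: "0 \<le> u" "u \<le> v"
    and near: "x - quant_dist x (\<alpha> n) / 4 \<le> u" "v \<le> x + quant_dist x (\<alpha> n) / 4"
  shows "((3 / 4) powr r - (1 / 4) powr r) * quant_dist x (\<alpha> n) powr r * (l * exp (- (l * v)) * (v - u))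
           \<le> err n - err (Suc n)"
proof -
  note fin = optimal_finite[OF n] and ne = optimal_nonempty[OF n]
  define d where "d = quant_dist x (\<alpha> n)"
  have d: "d \<ge> 0" using quant_dist_nonneg[OF fin ne] by (simp add: d_def)
  define \<kappa> where "\<kappa> = (3 / 4 :: real) powr r - (1 / 4) powr r"
  have \<kappa>: "\<kappa> > 0" using r by (simp add: \<kappa>_def powr_less_mono2)
  let ?A = "insert x (\<alpha> n)"
  have A: "finite ?A" "?A \<noteq> {}" using fin by auto
  have qA: "quantizer (Suc n) ?A"
    using fin optimal_card[OF n] card_insert_le_m1[of "Suc n" "\<alpha> n" x] by (simp add: quantizer_def)
  define g where "g = \<kappa> * d powr r * (l * exp (- (l * v)))"
  have g: "g \<ge> 0" using \<kappa> l by (simp add: g_def)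
  have [measurable]: "cost_density l r ?A \<in> borel_measurable borel"
    using A by (rule cost_density_measurable)
  have gain: "cost_density l r ?A y + g \<le> cost_density l r (\<alpha> n) y" if y: "y \<in> {u..v}" for y
  proof -
    have "quant_dist y ?A \<le> \<bar>y - x\<bar>" using A by (intro quant_dist_le) auto
    then have "quant_dist y ?A \<le> d * (1 / 4)" using y near by (auto simp: d_def)
    then have 1: "quant_dist y ?A powr r \<le> (d * (1 / 4)) powr r"
      using r quant_dist_nonneg[OF A] by (intro powr_mono2) auto
    have "d * (3 / 4) \<le> quant_dist y (\<alpha> n)"
      using quant_dist_lipschitz[OF fin ne, of x y] y near by (auto simp: d_def)
    then have 2: "(d * (3 / 4)) powr r \<le> quant_dist y (\<alpha> n) powr r"
      using r d by (intro powr_mono2) auto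
    have "\<kappa> * d powr r = (d * (3 / 4)) powr r - (d * (1 / 4)) powr r"
      using d unfolding \<kappa>_def by (subst (1 2) powr_mult) (auto simp: algebra_simps)
    then have 3: "\<kappa> * d powr r \<le> quant_dist y (\<alpha> n) powr r - quant_dist y ?A powr r"
      using 1 2 by linarith
    have "g \<le> (l * exp (- (l * y))) * (\<kappa> * d powr r)"
      using l \<kappa> y by (simp add: g_def mult_ac mult_left_mono)
    also have "\<dots> \<le> (l * exp (- (l * y))) * (quant_dist y (\<alpha> n) powr r - quant_dist y ?A powr r)"
      using 3 l by (intro mult_left_mono) auto
    finally show ?thesis by (simp add: cost_density_def right_diff_distrib)
  qed
  have mono: "cost_density l r ?A y \<le> cost_density l r (\<alpha> n) y" for y
    unfolding cost_density_def using l r A fin ne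
    by (intro mult_left_mono powr_mono2 quant_dist_antimono quant_dist_nonneg) auto
  have "ennreal (err (Suc n)) + ennreal (g * (v - u))
      \<le> distortion r (exp_law l) ?A + (\<integral>\<^sup>+y. ennreal g * indicator {u..v} y \<partial>lborel)"
    using optimal_le[OF _ qA] err_eq[of "Suc n"] g uv
    by (intro add_mono) (auto simp: nn_integral_cmult_indicator ennreal_mult)
  also have "\<dots> = (\<integral>\<^sup>+y. ennreal (cost_density l r ?A y) * indicator {0..} y
                          + ennreal g * indicator {u..v} y \<partial>lborel)"
    unfolding distortion_exp_law[OF A l] by (rule nn_integral_add[symmetric]) auto
  also have "\<dots> \<le> distortion r (exp_law l) (\<alpha> n)"
    unfolding distortion_exp_law[OF fin ne l] using gain mono g uv(1) cost_density_nonneg[OF l]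
    by (intro nn_integral_mono)
       (auto simp: indicator_def ennreal_plus[symmetric] simp del: ennreal_plus intro!: ennreal_leI)
  also have "\<dots> = ennreal (err n)" using err_eq[OF n] by simp
  also have "ennreal (err (Suc n)) + ennreal (g * (v - u)) = ennreal (err (Suc n) + g * (v - u))"
    using err_nonneg g uv by (simp add: ennreal_plus)
  finally have "err (Suc n) + g * (v - u) \<le> err n"
    using err_nonneg by (simp only: ennreal_le_iff)
  then show ?thesis by (simp add: g_def \<kappa>_def d_def mult_ac)
qed

text \<open>
  The gain of \<open>err_drop_ge_local_gain\<close> cannot exceed the decrement. If \<open>x \<ge> d / 4\<close>, the interval
  \<open>[x - d / 4, x]\<close> gives the bound. If \<open>x < d / 4\<close>, this interval would leave the support of the law; then
  \<open>[0, min (d / 4) (1 / l)]\<close> is used instead, on which the density is at least \<open>l exp (- 1)\<close>.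
\<close>

lemma quant_dist_upper:
  "\<exists>C>0. \<forall>n\<ge>1. \<forall>x\<ge>0. quant_dist x (\<alpha> n) \<le> C * exp (l * x / (r + 1)) / real n"
proof -
  obtain D where D: "D > 0" "\<And>n. n \<ge> 1 \<Longrightarrow> err n - err (Suc n) \<le> D * real n powr - (r + 1)"
    using err_drop_upper by blast
  define \<kappa> where "\<kappa> = (3 / 4 :: real) powr r - (1 / 4) powr r"
  have \<kappa>: "\<kappa> > 0" using r by (simp add: \<kappa>_def powr_less_mono2)
  define G where "G = D * exp 1 / \<kappa>"
  have G: "G > 0" using D \<kappa> by (simp add: G_def)
  \<comment> \<open>\<open>C1\<close> belongs to intervals of length \<open>d / 4\<close>, \<open>C2\<close> to the interval of length \<open>1 / l\<close>.\<close>
  define C1 where "C1 = (4 * G / l) powr (1 / (r + 1))"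
  define C2 where "C2 = G powr (1 / r)"
  have C: "C1 > 0" "C2 > 0" using G l by (auto simp: C1_def C2_def)
  have "quant_dist x (\<alpha> n) \<le> (C1 + C2) * exp (l * x / (r + 1)) / real n"
    if n: "n \<ge> 1" and x: "x \<ge> 0" for n x
  proof -
    define d where "d = quant_dist x (\<alpha> n)"
    have d0: "d \<ge> 0"
      using quant_dist_nonneg[OF optimal_finite optimal_nonempty, OF n n] by (simp add: d_def)
    define E where "E = exp (l * x / (r + 1)) / real n"
    have E: "E > 0" "1 / real n \<le> E" using l r x n by (auto simp: E_def divide_right_mono)
    have gain: "d powr r * (l * exp (- (l * v)) * (v - u)) \<le> G * exp (- 1) * real n powr - (r + 1)"
      if "0 \<le> u" "u \<le> v" "x - d / 4 \<le> u" "v \<le> x + d / 4" for u v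
    proof -
      have "\<kappa> * (d powr r * (l * exp (- (l * v)) * (v - u))) \<le> D * real n powr - (r + 1)"
        using err_drop_ge_local_gain[OF n that(1,2), of x] that(3,4) D(2)[OF n]
        by (simp add: d_def \<kappa>_def mult_ac)
      also have "\<dots> = \<kappa> * (G * exp (- 1) * real n powr - (r + 1))"
        using \<kappa> by (simp add: G_def exp_minus)
      finally show ?thesis using \<kappa> by simp
    qed
    have nr: "real n powr - (r + 1) = (1 / real n) powr (r + 1)"
      by (simp only: powr_minus) (simp add: powr_divide inverse_eq_divide)
    have root: "d \<le> C1 * E" if h: "d powr r * d \<le> 4 * G / l * exp (l * x) * real n powr - (r + 1)"
    proof (rule powr_le_powr_imp_le)
      have "(C1 * E) powr (r + 1) = C1 powr (r + 1) * (exp (l * x / (r + 1)) * (1 / real n)) powr (r + 1)"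
        using C E by (subst powr_mult) (auto simp: E_def)
      also have "\<dots> = 4 * G / l * (exp (l * x) * (1 / real n) powr (r + 1))"
        using G l r n by (subst powr_mult) (auto simp: C1_def powr_powr exp_powr_real)
      finally show "d powr (r + 1) \<le> (C1 * E) powr (r + 1)"
        using h nr d0 by (simp add: powr_add mult_ac)
    qed (use r C E in auto)
    have "d \<le> (C1 + C2) * E"
    proof (cases "d / 4 \<le> x")
      case True
      have "d powr r * (l * exp (- (l * x)) * (x - (x - d / 4))) \<le> G * exp (- 1) * real n powr - (r + 1)"
        using True d0 by (intro gain) auto
      also have "\<dots> \<le> G * 1 * real n powr - (r + 1)"
        using G by (intro mult_mono) auto
      finally have "d powr r * d \<le> 4 * G / l * exp (l * x) * real n powr - (r + 1)"
        using l by (simp add: exp_minus field_simps)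
      then have "d \<le> C1 * E" by (rule root)
      then show ?thesis using C E by (simp add: distrib_right add_increasing2)
    next
      case False
      define w where "w = min (d / 4) (1 / l)"
      have w: "0 \<le> w" "w \<le> d / 4" "l * w \<le> 1" using d0 l by (auto simp: w_def min_def field_simps)
      have "d powr r * (l * exp (- 1) * w) \<le> d powr r * (l * exp (- (l * w)) * w)"
        using w l by (intro mult_left_mono mult_right_mono) auto
      also have "\<dots> \<le> G * exp (- 1) * real n powr - (r + 1)"
        using gain[of 0 w] w x False by simp
      finally have h: "d powr r * (l * w) \<le> G * real n powr - (r + 1)" by (simp add: mult_ac)
      show ?thesis
      proof (cases "d / 4 \<le> 1 / l")
        case True
        then have "d powr r * d \<le> 4 * G / l * 1 * real n powr - (r + 1)"
          using h l by (simp add: w_def field_simps)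
        also have "\<dots> \<le> 4 * G / l * exp (l * x) * real n powr - (r + 1)"
          using G l x by (intro mult_right_mono mult_left_mono) auto
        finally have "d \<le> C1 * E" by (rule root)
        then show ?thesis using C E by (simp add: distrib_right add_increasing2)
      next
        case False
        then have "d powr r \<le> G * real n powr - (r + 1)" using h l by (simp add: w_def)
        \<comment> \<open>On an interval of fixed length the gain is only of order \<open>d\<^sup>r\<close>, so a power of \<open>n\<close> is given away to
          obtain the order \<open>1 / n\<close> for \<open>d\<close>.\<close>
        also have "\<dots> \<le> G * real n powr - r"
          using G n by (intro mult_left_mono powr_mono) auto
        also have "\<dots> = (C2 * (1 / real n)) powr r"
          using G r n by (subst powr_mult) (auto simp: C2_def powr_powr powr_minus powr_divide inverse_eq_divide)
        finally have le: "d powr r \<le> (C2 * (1 / real n)) powr r" .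
        have "d \<le> C2 * (1 / real n)"
          by (rule powr_le_powr_imp_le[OF r _ le]) (use C in simp)
        also have "\<dots> \<le> C2 * E" using C E by (intro mult_left_mono) auto
        finally show ?thesis using C E by (simp add: distrib_right add_increasing)
      qed
    qed
    then show ?thesis by (simp add: d_def E_def)
  qed
  moreover have "C1 + C2 > 0" using C by simp
  ultimately show ?thesis by blast
qed

text \<open>
  Inserting \<open>quant_dist_upper\<close> leaves the integral of \<open>exp (- c x)\<close> with
  \<open>c = l (1 - s / (\<theta> (r + 1)))\<close>, and \<open>c > 0\<close> is the condition on \<open>\<theta>\<close>.
\<close>

lemma rate_optimal_scaled:
  assumes s: "s > 0" and \<theta>: "\<theta> > s / (r + 1)"
  shows "rate_optimal s (exp_law l) (\<lambda>n. (\<lambda>a. \<theta> * a) ` \<alpha> n)"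
proof -
  obtain C where C: "C > 0"
    "\<And>n x. n \<ge> 1 \<Longrightarrow> x \<ge> 0 \<Longrightarrow> quant_dist x (\<alpha> n) \<le> C * exp (l * x / (r + 1)) / real n"
    using quant_dist_upper by blast
  have \<theta>0: "\<theta> > 0" using s r \<theta> by (meson add_pos_pos divide_pos_pos less_trans zero_less_one)
  define c where "c = l * (1 - s / (\<theta> * (r + 1)))"
  have "s / (\<theta> * (r + 1)) < 1"
    using \<theta> \<theta>0 r by (subst pos_divide_less_eq) (auto simp: pos_divide_less_eq)
  then have c: "c > 0" unfolding c_def using l by simp
  define B where "B = l * (\<theta> * C) powr s / c"
  have bound: "ennreal (real n powr s) * distortion s (exp_law l) ((\<lambda>a. \<theta> * a) ` \<alpha> n) \<le> ennreal B"
    if n: "n \<ge> 1" for n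
  proof -
    note fin = optimal_finite[OF n] and ne = optimal_nonempty[OF n]
    let ?A = "(\<lambda>a. \<theta> * a) ` \<alpha> n"
    have A: "finite ?A" "?A \<noteq> {}" using fin ne by auto
    let ?k = "l * (\<theta> * C) powr s * real n powr - s"
    have "cost_density l s ?A x \<le> ?k * exp (- (c * x))" if x: "x \<ge> 0" for x
    proof -
      have "quant_dist x ?A \<le> \<theta> * (C * exp (l * (x / \<theta>) / (r + 1)) / real n)"
        unfolding quant_dist_scale[OF fin ne \<theta>0]
        using C(2)[OF n, of "x / \<theta>"] x \<theta>0 by (intro mult_left_mono) auto
      also have "\<dots> = (\<theta> * C) * (exp (l * (x / \<theta>) / (r + 1)) * (1 / real n))" by simp
      finally have "quant_dist x ?A powr s \<le> ((\<theta> * C) * (exp (l * (x / \<theta>) / (r + 1)) * (1 / real n))) powr s"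
        using s quant_dist_nonneg[OF A] by (intro powr_mono2) auto
      also have "\<dots> = (\<theta> * C) powr s * (exp (s * (l * (x / \<theta>) / (r + 1))) * real n powr - s)"
        using C(1) \<theta>0 n
        by (simp add: powr_mult powr_divide exp_powr_real powr_minus inverse_eq_divide mult_ac)
      finally have "cost_density l s ?A x
          \<le> l * exp (- (l * x)) * ((\<theta> * C) powr s * (exp (s * (l * (x / \<theta>) / (r + 1))) * real n powr - s))"
        unfolding cost_density_def using l by (intro mult_left_mono) auto
      also have "\<dots> = ?k * (exp (- (l * x)) * exp (s * (l * (x / \<theta>) / (r + 1))))" by simp
      also have "exp (- (l * x)) * exp (s * (l * (x / \<theta>) / (r + 1))) = exp (- (c * x))"
        using \<theta>0 r by (simp add: c_def algebra_simps flip: exp_add)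
      finally show ?thesis .
    qed
    then have "distortion s (exp_law l) ?A
        \<le> (\<integral>\<^sup>+x. ennreal ?k * (ennreal (exp (- (c * x))) * indicator {0..} x) \<partial>lborel)"
      unfolding distortion_exp_law[OF A l] using l
      by (intro nn_integral_mono)
         (auto simp: indicator_def ennreal_mult'[symmetric] intro!: ennreal_leI)
    also have "\<dots> = ennreal ?k * ennreal (1 / c)"
      using c by (subst nn_integral_cmult) (auto simp: nn_integral_exp_decay)
    finally have "ennreal (real n powr s) * distortion s (exp_law l) ?A
        \<le> ennreal (real n powr s) * (ennreal ?k * ennreal (1 / c))"
      by (rule mult_left_mono) simp
    also have "\<dots> = ennreal (real n powr s * (?k * (1 / c)))"
      using l c
      by (subst ennreal_mult[symmetric], simp, simp, subst ennreal_mult[symmetric], simp_all)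
    also have "real n powr s * (?k * (1 / c)) = B"
      using n by (simp add: B_def powr_minus)
    finally show ?thesis .
  qed
  have "limsup (\<lambda>n. ennreal (real n powr s) * distortion s (exp_law l) ((\<lambda>a. \<theta> * a) ` \<alpha> n)) \<le> ennreal B"
    by (intro Limsup_bounded eventually_sequentiallyI[of 1] bound)
  also have "\<dots> < \<infinity>" by simp
  finally show ?thesis by (simp add: rate_optimal_def)
qed

section \<open>Deleting a point: the scaled quantizers that are not rate-optimal\<close>

text \<open>
  Delete a point \<open>q\<close> of \<open>\<alpha> (n + 1)\<close> that lies between two others, \<open>p\<close> and \<open>q'\<close>, all in \<open>[u, u + L]\<close>.
  Outside \<open>[p, q']\<close> one of \<open>p\<close> and \<open>q'\<close> is closer than \<open>q\<close>, so nothing is lost there; inside, \<open>p\<close> is still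
  within \<open>L\<close>.
\<close>

lemma err_drop_le_if_crowded:
  assumes n: "n \<ge> 1" and u: "u \<ge> 0" and L: "L > 0"
    and crowded: "3 \<le> card (\<alpha> (Suc n) \<inter> {u..u + L})"
  shows "err n - err (Suc n) \<le> l * exp (- (l * u)) * L powr r * L"
proof -
  let ?A = "\<alpha> (Suc n)"
  have fin: "finite ?A" and ne: "?A \<noteq> {}" and card: "card ?A \<le> Suc n"
    using optimal_finite[of "Suc n"] optimal_nonempty[of "Suc n"] optimal_card[of "Suc n"] by auto
  obtain p q q' where pq: "p \<in> ?A \<inter> {u..u + L}" "q \<in> ?A \<inter> {u..u + L}" "q' \<in> ?A \<inter> {u..u + L}"
    "p < q" "q < q'"
    using ex_between_of_card_ge_3[OF crowded] .
  define B where "B = ?A - {q}"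
  have B: "finite B" "B \<noteq> {}" "p \<in> B" "q' \<in> B" using fin pq by (auto simp: B_def)
  have qB: "quantizer n B"
    using B card pq(2) fin by (simp add: quantizer_def B_def)
  define g where "g = l * exp (- (l * u)) * L powr r"
  have g: "g \<ge> 0" using l by (simp add: g_def)
  have loss: "cost_density l r B y \<le> cost_density l r ?A y + g * indicator {u..u + L} y" for y
  proof (cases "y \<in> {p..q'}")
    case True
    then have y: "y \<in> {u..u + L}" using pq by auto
    have "quant_dist y B \<le> \<bar>y - p\<bar>" using B by (intro quant_dist_le)
    also have "\<dots> \<le> L" using True pq by auto
    finally have "quant_dist y B powr r \<le> L powr r"
      using r quant_dist_nonneg[OF B(1,2)] by (intro powr_mono2) auto
    then have "cost_density l r B y \<le> g"
      unfolding cost_density_def g_def using l y by (intro mult_mono) auto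
    then show ?thesis using y cost_density_nonneg[OF l, of r ?A y] by simp
  next
    case False
    obtain z where z: "z \<in> ?A" "quant_dist y ?A = \<bar>y - z\<bar>" using fin ne by (rule quant_dist_attained)
    have "\<exists>z'\<in>B. \<bar>y - z'\<bar> \<le> \<bar>y - z\<bar>"
    proof (cases "z = q")
      case True
      consider "y < p" | "q' < y" using False by force
      then show ?thesis
      proof cases
        case 1
        then have "\<bar>y - p\<bar> \<le> \<bar>y - z\<bar>" using True pq by simp
        then show ?thesis using B(3) by blast
      next
        case 2
        then have "\<bar>y - q'\<bar> \<le> \<bar>y - z\<bar>" using True pq by simp
        then show ?thesis using B(4) by blast
      qed
    next
      case False
      then show ?thesis using z by (auto simp: B_def)
    qed
    then obtain z' where "z' \<in> B" "\<bar>y - z'\<bar> \<le> \<bar>y - z\<bar>" by blast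
    then have "quant_dist y B \<le> quant_dist y ?A"
      using quant_dist_le[OF B(1), of z' y] z(2) by simp
    then have "cost_density l r B y \<le> cost_density l r ?A y"
      unfolding cost_density_def using l r quant_dist_nonneg[OF B(1,2)]
      by (intro mult_left_mono powr_mono2) auto
    then show ?thesis using g by (simp add: add_increasing2)
  qed
  have [measurable]: "cost_density l r ?A \<in> borel_measurable borel"
    using fin ne by (rule cost_density_measurable)
  have "distortion r (exp_law l) B
      \<le> (\<integral>\<^sup>+y. ennreal (cost_density l r ?A y) * indicator {0..} y
            + ennreal g * indicator {u..u + L} y \<partial>lborel)"
    unfolding distortion_exp_law[OF B(1,2) l]
  proof (rule nn_integral_mono)
    fix y
    show "ennreal (cost_density l r B y) * indicator {0..} y
        \<le> ennreal (cost_density l r ?A y) * indicator {0..} y + ennreal g * indicator {u..u + L} y"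
      using loss[of y] g cost_density_nonneg[OF l, of r ?A y] u
      by (auto simp: indicator_def ennreal_plus[symmetric] simp del: ennreal_plus intro!: ennreal_leI)
  qed
  also have "\<dots> = distortion r (exp_law l) ?A + (\<integral>\<^sup>+y. ennreal g * indicator {u..u + L} y \<partial>lborel)"
    unfolding distortion_exp_law[OF fin ne l] by (rule nn_integral_add) auto
  also have "\<dots> = ennreal (err (Suc n) + g * L)"
    using err_eq[of "Suc n"] err_nonneg g L
    by (simp add: nn_integral_cmult_indicator ennreal_plus ennreal_mult)
  finally have "err n \<le> err (Suc n) + g * L"
    using g L err_nonneg by (intro err_le[OF n qB]) auto
  then show ?thesis by (simp add: g_def)
qed

text \<open>
  Cut \<open>[k, k + 1]\<close> into \<open>N\<close> intervals of length \<open>1 / N\<close>. For \<open>N\<close> beyond the threshold,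
  \<open>err_drop_le_if_crowded\<close> contradicts \<open>err_drop_lower\<close> on any of them that contains three points.
\<close>

lemma card_unit_interval_le:
  "\<exists>b>0. \<forall>n\<ge>1. \<forall>k N :: nat. b * exp (- (l * real k / (r + 1))) * real n < real N
      \<longrightarrow> card (\<alpha> (Suc n) \<inter> {real k..real k + 1}) \<le> 2 * N"
proof -
  obtain c where c: "c > 0" "\<And>n. n \<ge> 1 \<Longrightarrow> c * real n powr - (r + 1) \<le> err n - err (Suc n)"
    using err_drop_lower by blast
  define b where "b = (l / c) powr (1 / (r + 1))"
  have b: "b > 0" using l c by (simp add: b_def)
  have "card (\<alpha> (Suc n) \<inter> {real k..real k + 1}) \<le> 2 * N"
    if n: "n \<ge> 1" and N: "b * exp (- (l * real k / (r + 1))) * real n < real N" for n k N :: nat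
  proof -
    have N0: "real N > 0" using N b by (meson exp_gt_zero le_less_trans mult_nonneg_nonneg less_imp_le of_nat_0_le_iff)
    let ?I = "\<lambda>i. {real k + real i / real N..real k + real i / real N + 1 / real N}"
    have sparse: "card (\<alpha> (Suc n) \<inter> ?I i) \<le> 2" for i
    proof (rule ccontr)
      assume "\<not> ?thesis"
      then have "3 \<le> card (\<alpha> (Suc n) \<inter> ?I i)" by simp
      then have "c * real n powr - (r + 1)
          \<le> l * exp (- (l * (real k + real i / real N))) * (1 / real N) powr r * (1 / real N)"
        using c(2)[OF n] err_drop_le_if_crowded[OF n, of "real k + real i / real N" "1 / real N"] N0
        by auto
      also have "\<dots> \<le> l * exp (- (l * real k)) * (1 / real N) powr r * (1 / real N)"
        using l by (intro mult_left_mono mult_right_mono) auto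
      also have "\<dots> = l * exp (- (l * real k)) * real N powr - (r + 1)"
      proof -
        have "(1 / real N) powr r * (1 / real N) = (1 / real N) powr (r + 1)"
          using N0 by (simp add: powr_add)
        also have "\<dots> = real N powr - (r + 1)"
          by (simp only: powr_minus) (simp add: powr_divide inverse_eq_divide)
        finally show ?thesis by (simp only: mult.assoc)
      qed
      finally have "real N powr (r + 1) \<le> l / c * exp (- (l * real k)) * real n powr (r + 1)"
        using c N0 n by (simp only: powr_minus) (simp add: field_simps)
      also have "\<dots> = (b * exp (- (l * real k / (r + 1))) * real n) powr (r + 1)"
        using l c r by (simp add: b_def powr_mult powr_powr exp_powr_real)
      finally have le: "real N powr (r + 1) \<le> (b * exp (- (l * real k / (r + 1))) * real n) powr (r + 1)" .
      have "real N \<le> b * exp (- (l * real k / (r + 1))) * real n"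
        by (rule powr_le_powr_imp_le[OF _ _ le]) (use r b in simp_all)
      then show False using N by simp
    qed
    have "{real k..real k + 1} \<subseteq> (\<Union>i<N. ?I i)"
    proof
      fix x assume x: "x \<in> {real k..real k + 1}"
      define y where "y = (x - real k) * real N"
      have y: "0 \<le> y" "y \<le> real N" "x = real k + y / real N"
        using x N0 by (auto simp: y_def mult_left_le_one_le)
      have "\<exists>i<N. real i \<le> y \<and> y \<le> real i + 1"
      proof (cases "y = real N")
        case True
        then show ?thesis using N0 by (intro exI[of _ "N - 1"]) (auto simp: of_nat_diff)
      next
        case False
        then have "y < real N" using y by simp
        then have "nat \<lfloor>y\<rfloor> < N" using y by (simp add: floor_less_iff nat_less_iff)
        moreover have "real (nat \<lfloor>y\<rfloor>) \<le> y" "y \<le> real (nat \<lfloor>y\<rfloor>) + 1" using y(1) by linarith+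
        ultimately show ?thesis by blast
      qed
      then obtain i where i: "i < N" "real i \<le> y" "y \<le> real i + 1" by blast
      have "real i / real N \<le> y / real N" "y / real N \<le> (real i + 1) / real N"
        using i N0 by (auto intro: divide_right_mono)
      then have "x \<in> ?I i" using y(3) by (simp add: add_divide_distrib)
      then show "x \<in> (\<Union>i<N. ?I i)" using i by blast
    qed
    then have "\<alpha> (Suc n) \<inter> {real k..real k + 1} \<subseteq> (\<Union>i<N. \<alpha> (Suc n) \<inter> ?I i)" by blast
    then have "card (\<alpha> (Suc n) \<inter> {real k..real k + 1}) \<le> card (\<Union>i<N. \<alpha> (Suc n) \<inter> ?I i)"
      using optimal_finite[of "Suc n"] by (intro card_mono) auto
    also have "\<dots> \<le> (\<Sum>i<N. card (\<alpha> (Suc n) \<inter> ?I i))" by (rule card_UN_le) simp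
    also have "\<dots> \<le> (\<Sum>i<N. 2)" by (intro sum_mono sparse)
    finally show ?thesis by simp
  qed
  then show ?thesis using b by blast
qed

text \<open>
  Up to the critical scaling every block of length \<open>\<theta>\<close> carries an error of order at least \<open>n\<^sup>-\<^sup>s\<close>, with a
  constant \<open>c\<close> independent of the block \<open>k\<close>: the number of points in the block is at most of order
  \<open>n exp (- l k / (r + 1))\<close>, and the resulting factor \<open>exp (l k s / (r + 1))\<close> of the error compensates
  the decay \<open>exp (- l \<theta> k)\<close> of the density. The level from which this holds depends on \<open>k\<close>, because
  \<open>n\<close> has to be so large that the bound on the number of points exceeds \<open>1\<close>.
\<close>

lemma scaled_block_distortion_ge:
  assumes s: "s > 0" and \<theta>: "0 < \<theta>" "\<theta> \<le> s / (r + 1)"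
  shows "\<exists>c>0. \<forall>k::nat. \<exists>m\<ge>1. \<forall>n\<ge>m.
    ennreal (c * real n powr - s) \<le> (\<integral>\<^sup>+x\<in>{\<theta> * real k..<\<theta> * real k + \<theta>}.
        ennreal (cost_density l s ((\<lambda>a. \<theta> * a) ` \<alpha> (Suc n)) x) \<partial>lborel)"
proof -
  obtain b where b: "b > 0" "\<And>n k N. n \<ge> 1 \<Longrightarrow>
      b * exp (- (l * real k / (r + 1))) * real n < real N \<Longrightarrow>
      card (\<alpha> (Suc n) \<inter> {real k..real k + 1}) \<le> 2 * N"
    using card_unit_interval_le by blast
  define c where "c = l * exp (- (l * \<theta>)) * (\<theta> / 2 * (\<theta> / (20 * b)) powr s)"
  have c: "c > 0" using l \<theta> b by (simp add: c_def)
  have "\<exists>m\<ge>1. \<forall>n\<ge>m.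
    ennreal (c * real n powr - s) \<le> (\<integral>\<^sup>+x\<in>{\<theta> * real k..<\<theta> * real k + \<theta>}.
        ennreal (cost_density l s ((\<lambda>a. \<theta> * a) ` \<alpha> (Suc n)) x) \<partial>lborel)" for k
  proof -
    define w where "w = b * exp (- (l * real k / (r + 1)))"
    have w: "w > 0" using b by (simp add: w_def)
    define m where "m = nat \<lceil>1 / w\<rceil> + 1"
    show ?thesis
    proof (intro exI[of _ m] conjI allI impI)
      fix n assume nm: "n \<ge> m"
      then have n: "n \<ge> 1" by (simp add: m_def)
      have "1 / w \<le> real m" unfolding m_def by linarith
      also have "\<dots> \<le> real n" using nm by simp
      finally have y1: "1 \<le> w * real n" using w by (simp add: field_simps)
      define N where "N = nat \<lfloor>w * real n\<rfloor> + 1"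
      have N: "w * real n < real N" "real N \<le> w * real n + 1" using y1 unfolding N_def by linarith+
      note fin = optimal_finite[of "Suc n", simplified] and ne = optimal_nonempty[of "Suc n", simplified]
      let ?A = "(\<lambda>a. \<theta> * a) ` \<alpha> (Suc n)"
      have A: "finite ?A" "?A \<noteq> {}" using fin ne by auto
      have "?A \<inter> {\<theta> * real k..\<theta> * real k + \<theta>} \<subseteq> (\<lambda>a. \<theta> * a) ` (\<alpha> (Suc n) \<inter> {real k..real k + 1})"
      proof -
        have "a \<le> real k + 1" if "\<theta> * a \<le> \<theta> * real k + \<theta>" for a
        proof -
          have "\<theta> * a \<le> \<theta> * (real k + 1)" using that by (simp add: distrib_left)
          then show ?thesis using \<theta> by simp
        qed
        then show ?thesis using \<theta> by auto
      qed
      then have "card (?A \<inter> {\<theta> * real k..\<theta> * real k + \<theta>}) \<le> card ((\<lambda>a. \<theta> * a) ` (\<alpha> (Suc n) \<inter> {real k..real k + 1}))"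
        using fin by (intro card_mono) auto
      also have "\<dots> \<le> card (\<alpha> (Suc n) \<inter> {real k..real k + 1})"
        using fin by (intro card_image_le) auto
      also have "\<dots> \<le> 2 * N" using N(1) unfolding w_def by (rule b(2)[OF n])
      finally have card: "card (?A \<inter> {\<theta> * real k..\<theta> * real k + \<theta>}) \<le> 2 * N" .
      \<comment> \<open>Rounding is absorbed by \<open>w n \<ge> 1\<close>: \<open>2 N + 1 \<le> 2 w n + 3 \<le> 5 w n\<close>.\<close>
      have le5: "4 * (real (2 * N) + 1) \<le> 20 * (w * real n)" using N(2) y1 by simp
      have "(\<theta> / (20 * b)) powr s * (exp (l * real k * s / (r + 1)) * real n powr - s)
          = (\<theta> / (20 * b) * (exp (l * real k / (r + 1)) * (1 / real n))) powr s"
        using \<theta> b n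
        by (simp add: powr_mult powr_divide exp_powr_real powr_minus inverse_eq_divide mult_ac)
      also have "\<theta> / (20 * b) * (exp (l * real k / (r + 1)) * (1 / real n)) = \<theta> / (20 * (w * real n))"
        unfolding w_def using b n by (simp add: exp_minus field_simps)
      also have "(\<theta> / (20 * (w * real n))) powr s \<le> (\<theta> / (4 * (real (2 * N) + 1))) powr s"
        using le5 \<theta> s w n by (intro powr_mono2 divide_left_mono) auto
      finally have dist: "(\<theta> / (20 * b)) powr s * (exp (l * real k * s / (r + 1)) * real n powr - s)
          \<le> (\<theta> / (4 * (real (2 * N) + 1))) powr s" .
      have "\<theta> * (l * real k) \<le> s / (r + 1) * (l * real k)"
        using \<theta> l by (intro mult_right_mono) auto
      then have "1 \<le> exp (- (l * (\<theta> * real k))) * exp (l * real k * s / (r + 1))"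
        by (simp add: mult_ac flip: exp_add)
      then have "1 * (c * real n powr - s)
          \<le> exp (- (l * (\<theta> * real k))) * exp (l * real k * s / (r + 1)) * (c * real n powr - s)"
        using c by (intro mult_right_mono) auto
      also have "\<dots> = l * exp (- (l * (\<theta> * real k + \<theta>))) *
          (\<theta> / 2 * ((\<theta> / (20 * b)) powr s * (exp (l * real k * s / (r + 1)) * real n powr - s)))"
      proof -
        have "exp (- (l * (\<theta> * real k + \<theta>))) = exp (- (l * (\<theta> * real k))) * exp (- (l * \<theta>))"
          by (simp add: distrib_left flip: exp_add)
        then show ?thesis unfolding c_def by (simp add: mult_ac)
      qed
      also have "\<dots> \<le> l * exp (- (l * (\<theta> * real k + \<theta>))) * (\<theta> / 2 * (\<theta> / (4 * (real (2 * N) + 1))) powr s)"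
        using dist l \<theta> by (intro mult_left_mono) auto
      also have "ennreal \<dots> \<le> (\<integral>\<^sup>+x\<in>{\<theta> * real k..<\<theta> * real k + \<theta>}. ennreal (cost_density l s ?A x) \<partial>lborel)"
        by (rule distortion_exp_law_interval_ge[OF A l \<theta>(1) s card])
      finally show "ennreal (c * real n powr - s)
          \<le> (\<integral>\<^sup>+x\<in>{\<theta> * real k..<\<theta> * real k + \<theta>}. ennreal (cost_density l s ?A x) \<partial>lborel)"
        by (simp add: ennreal_leI)
    qed (simp add: m_def)
  qed
  then show ?thesis using c by blast
qed

text \<open>
  The first \<open>K\<close> blocks together contribute at least \<open>K c n\<^sup>-\<^sup>s\<close> for large \<open>n\<close>, so the upper limit is at
  least \<open>K c\<close> for every \<open>K\<close>.
\<close>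

lemma not_rate_optimal_scaled:
  assumes s: "s > 0" and \<theta>: "0 < \<theta>" "\<theta> \<le> s / (r + 1)"
  shows "\<not> rate_optimal s (exp_law l) (\<lambda>n. (\<lambda>a. \<theta> * a) ` \<alpha> n)"
proof
  assume rate: "rate_optimal s (exp_law l) (\<lambda>n. (\<lambda>a. \<theta> * a) ` \<alpha> n)"
  let ?A = "\<lambda>n. (\<lambda>a. \<theta> * a) ` \<alpha> n"
  let ?D = "\<lambda>n. ennreal (real n powr s) * distortion s (exp_law l) (?A n)"
  obtain c where c: "c > 0" "\<And>k. \<exists>m\<ge>1. \<forall>n\<ge>m.
    ennreal (c * real n powr - s) \<le> (\<integral>\<^sup>+x\<in>{\<theta> * real k..<\<theta> * real k + \<theta>}.
        ennreal (cost_density l s (?A (Suc n)) x) \<partial>lborel)"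
    using scaled_block_distortion_ge[OF s \<theta>] by blast
  have A: "finite (?A (Suc n))" "?A (Suc n) \<noteq> {}" for n
    using optimal_finite[of "Suc n"] optimal_nonempty[of "Suc n"] by auto
  have blocks: "\<exists>m\<ge>1. \<forall>n\<ge>m. ennreal (real K * (c * real n powr - s))
      \<le> (\<integral>\<^sup>+x\<in>{0..<\<theta> * real K}. ennreal (cost_density l s (?A (Suc n)) x) \<partial>lborel)" for K :: nat
  proof (induction K)
    case 0
    show ?case by auto
  next
    case (Suc K)
    then obtain m1 where m1: "m1 \<ge> 1" "\<And>n. n \<ge> m1 \<Longrightarrow> ennreal (real K * (c * real n powr - s))
      \<le> (\<integral>\<^sup>+x\<in>{0..<\<theta> * real K}. ennreal (cost_density l s (?A (Suc n)) x) \<partial>lborel)" by blast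
    obtain m2 where m2: "m2 \<ge> 1" "\<And>n. n \<ge> m2 \<Longrightarrow> ennreal (c * real n powr - s)
      \<le> (\<integral>\<^sup>+x\<in>{\<theta> * real K..<\<theta> * real K + \<theta>}. ennreal (cost_density l s (?A (Suc n)) x) \<partial>lborel)"
      using c(2) by blast
    show ?case
    proof (intro exI[of _ "max m1 m2"] conjI allI impI)
      fix n assume n: "n \<ge> max m1 m2"
      have [measurable]: "cost_density l s (?A (Suc n)) \<in> borel_measurable borel"
        using A by (rule cost_density_measurable)
      have "ennreal (real (Suc K) * (c * real n powr - s))
          = ennreal (real K * (c * real n powr - s)) + ennreal (c * real n powr - s)"
        using c by (subst ennreal_plus[symmetric]) (auto simp: algebra_simps)
      also have "\<dots> \<le> (\<integral>\<^sup>+x\<in>{0..<\<theta> * real K}. ennreal (cost_density l s (?A (Suc n)) x) \<partial>lborel)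
          + (\<integral>\<^sup>+x\<in>{\<theta> * real K..<\<theta> * real K + \<theta>}. ennreal (cost_density l s (?A (Suc n)) x) \<partial>lborel)"
        using n m1 m2 by (intro add_mono) auto
      also have "\<dots> = (\<integral>\<^sup>+x\<in>{0..<\<theta> * real K} \<union> {\<theta> * real K..<\<theta> * real K + \<theta>}.
          ennreal (cost_density l s (?A (Suc n)) x) \<partial>lborel)"
        by (rule nn_integral_disjoint_pair[symmetric]) auto
      also have "{0..<\<theta> * real K} \<union> {\<theta> * real K..<\<theta> * real K + \<theta>} = {0..<\<theta> * real (Suc K)}"
        using \<theta> by (subst ivl_disj_un_two(3)) (auto simp: algebra_simps)
      finally show "ennreal (real (Suc K) * (c * real n powr - s))
          \<le> (\<integral>\<^sup>+x\<in>{0..<\<theta> * real (Suc K)}. ennreal (cost_density l s (?A (Suc n)) x) \<partial>lborel)" .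
    qed (use m1 in simp)
  qed
  have ge: "ennreal (real K * c) \<le> limsup ?D" for K :: nat
  proof -
    obtain m where m: "m \<ge> 1" "\<And>n. n \<ge> m \<Longrightarrow> ennreal (real K * (c * real n powr - s))
      \<le> (\<integral>\<^sup>+x\<in>{0..<\<theta> * real K}. ennreal (cost_density l s (?A (Suc n)) x) \<partial>lborel)"
      using blocks by blast
    have "ennreal (real K * c) \<le> ?D n" if nm: "n \<ge> Suc m" for n
    proof -
      obtain n' where n': "n = Suc n'" "n' \<ge> m" using nm by (metis Suc_le_D Suc_le_mono)
      have "real K * c = real n' powr s * (real K * (c * real n' powr - s))"
        using n' m(1) by (simp add: powr_minus)
      also have "\<dots> \<le> real n powr s * (real K * (c * real n' powr - s))"
        using c s n' by (intro mult_right_mono powr_mono2) auto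
      finally have "ennreal (real K * c) \<le> ennreal (real n powr s) * ennreal (real K * (c * real n' powr - s))"
        using c by (subst ennreal_mult[symmetric]) (auto intro: ennreal_leI)
      also have "ennreal (real n powr s) * ennreal (real K * (c * real n' powr - s)) \<le> ?D n"
      proof (rule mult_left_mono)
        have K0: "0 \<le> \<theta> * real K" using \<theta> by simp
        have "ennreal (real K * (c * real n' powr - s))
            \<le> (\<integral>\<^sup>+x\<in>{0..<\<theta> * real K}. ennreal (cost_density l s (?A (Suc n')) x) \<partial>lborel)"
          by (rule m(2)[OF n'(2)])
        also have "\<dots> \<le> \<dots> + (\<integral>\<^sup>+x\<in>{\<theta> * real K..}. ennreal (cost_density l s (?A (Suc n')) x) \<partial>lborel)"
          by (rule add_increasing2[OF _ order_refl]) simp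
        also have "\<dots> = distortion s (exp_law l) (?A (Suc n'))"
          by (rule distortion_exp_law_split[OF A l K0, symmetric])
        finally show "ennreal (real K * (c * real n' powr - s)) \<le> distortion s (exp_law l) (?A n)"
          unfolding n'(1) .
      qed simp
      finally show ?thesis .
    qed
    then have "ennreal (real K * c) \<le> liminf ?D"
      by (intro Liminf_bounded eventually_sequentiallyI[of "Suc m"])
    also have "\<dots> \<le> limsup ?D" by (intro Liminf_le_Limsup) simp
    finally show ?thesis .
  qed
  have fin: "limsup ?D < \<infinity>" using rate by (simp add: rate_optimal_def)
  define z where "z = enn2real (limsup ?D)"
  have z: "limsup ?D = ennreal z" "z \<ge> 0" using fin by (auto simp: z_def)
  obtain K :: nat where "z / c < real K" using reals_Archimedean2 by blast
  then have "z < real K * c" using c by (simp add: field_simps)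
  moreover have "real K * c \<le> z" using ge[of K] z by (simp add: ennreal_le_iff)
  ultimately show False by simp
qed

end

section \<open>Minimizing a quotient of powers\<close>

text \<open>
  Strict concavity of the logarithm between \<open>z\<close> and \<open>1\<close>, obtained from the tangent inequality
  \<open>ln y \<le> y - 1\<close> at \<open>z / x\<close> and \<open>1 / x\<close>, where \<open>x\<close> is the weighted mean.
\<close>

lemma weighted_AM_GM_strict:
  assumes "0 < w" "w < 1" "0 < z" "z \<noteq> (1::real)"
  shows "w * ln z < ln (w * z + (1 - w))"
proof -
  define x where "x = w * z + (1 - w)"
  have x: "x > 0" unfolding x_def using assms by (simp add: add_pos_pos)
  have "x - 1 = w * (z - 1)" by (simp add: x_def algebra_simps)
  then have "x \<noteq> 1" using assms by auto
  then have "ln (1 / x) < 1 / x - 1"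
    using x ln_le_minus_one[of "1 / x"] ln_eq_minus_one[of "1 / x"] by fastforce
  then have 1: "(1 - w) * ln (1 / x) < (1 - w) * (1 / x - 1)"
    using assms by (intro mult_strict_left_mono) auto
  have 2: "w * ln (z / x) \<le> w * (z / x - 1)"
    using assms x by (intro mult_left_mono ln_le_minus_one) auto
  have "w * (z / x - 1) + (1 - w) * (1 / x - 1) = x / x - 1"
    unfolding add_divide_distrib x_def by (simp add: algebra_simps add_divide_distrib diff_divide_distrib)
  also have "\<dots> = 0" using x by simp
  finally have "w * ln (z / x) + (1 - w) * ln (1 / x) < 0" using 1 2 by linarith
  moreover have "w * ln (z / x) + (1 - w) * ln (1 / x) = w * ln z - ln x"
    using x assms by (simp add: ln_div algebra_simps)
  ultimately show ?thesis by (simp add: x_def)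
qed

lemma powr_quotient_min_gt_pole:
  fixes p q c :: real
  assumes "0 < q" "q < p" "0 < c"
  shows "c < p * c / (p - q)"
proof -
  have "p * c / (p - q) - c = q * c / (p - q)" using assms by (simp add: field_simps)
  also have "\<dots> > 0" using assms by simp
  finally show ?thesis by simp
qed

text \<open>
  Put \<open>z = (\<theta> - c) / (m - c)\<close>. The choice of \<open>m\<close> makes \<open>\<theta> / m\<close> the weighted mean of \<open>z\<close> and \<open>1\<close> with weight
  \<open>q / p\<close> on \<open>z\<close>, and the claim becomes the strict concavity of the logarithm.
\<close>

lemma powr_quotient_strict_min:
  fixes p q c \<theta> :: real
  assumes "0 < q" "q < p" "0 < c" "c < \<theta>" "\<theta> \<noteq> p * c / (p - q)"
  defines "m \<equiv> p * c / (p - q)"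
  shows "m powr p * (m - c) powr - q < \<theta> powr p * (\<theta> - c) powr - q"
proof -
  have mc: "m - c = q * c / (p - q)" unfolding m_def using assms by (simp add: field_simps)
  have "c < m" unfolding m_def using assms(1-3) by (rule powr_quotient_min_gt_pole)
  then have m: "m > 0" using assms by simp
  define z where "z = (\<theta> - c) / (m - c)"
  have z: "z > 0" "z \<noteq> 1" using assms \<open>c < m\<close> by (auto simp: z_def)
  have "q / p * z + (1 - q / p) = \<theta> / m"
    unfolding z_def mc unfolding m_def using assms by (simp add: field_simps)
  then have "q / p * ln z < ln (\<theta> / m)"
    using weighted_AM_GM_strict[of "q / p" z] assms z by simp
  then have "q * ln z < p * ln (\<theta> / m)" using assms by (simp add: field_simps)
  then have "p * ln m - q * ln (m - c) < p * ln \<theta> - q * ln (\<theta> - c)"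
    using assms(1-4) m \<open>c < m\<close> by (simp add: z_def ln_div algebra_simps)
  then show "m powr p * (m - c) powr - q < \<theta> powr p * (\<theta> - c) powr - q"
    using assms(1-4) m \<open>c < m\<close> by (simp add: powr_def flip: exp_add)
qed

lemma is_arg_min_powr_quotient:
  fixes Q :: "real \<Rightarrow> ennreal"
  assumes Q: "\<And>\<theta>. c < \<theta> \<Longrightarrow> Q \<theta> = ennreal (K * (\<theta> powr p * (\<theta> - c) powr - q))"
    and "K > 0" "0 < q" "q < p" "0 < c"
  shows "is_arg_min Q (\<lambda>\<theta>. \<theta> \<in> {c<..}) t \<longleftrightarrow> t = p * c / (p - q)"
proof -
  define m where "m = p * c / (p - q)"
  have m: "c < m" unfolding m_def using assms(3-5) by (rule powr_quotient_min_gt_pole)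
  have less: "Q m < Q \<theta>" if "c < \<theta>" "\<theta> \<noteq> m" for \<theta>
  proof -
    have "m powr p * (m - c) powr - q < \<theta> powr p * (\<theta> - c) powr - q"
      using powr_quotient_strict_min[of q p c \<theta>] assms that by (simp add: m_def)
    then show ?thesis
      using \<open>K > 0\<close> that m by (simp add: Q ennreal_less_iff mult_nonneg_nonneg)
  qed
  have "\<not> Q y < Q m" if "c < y" for y
    using less[OF that] by (cases "y = m") auto
  then show ?thesis
    unfolding is_arg_min_def m_def[symmetric] using less m by auto
qed

section \<open>The asymptotic upper constant of the exponential law\<close>

lemma ennreal_powr_ennreal: "a \<ge> 0 \<Longrightarrow> ennreal_powr (ennreal a) p = ennreal (a powr p)"
  by (simp add: ennreal_powr_def)

text \<open>
  This makes the factor \<open>Q_const\<close> of the functional positive and finite; otherwise the functional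
  would be constantly \<open>0\<close> or \<open>\<infinity>\<close> and would not single out a scaling. The lower bound is that of
  \<open>interval_distortion_ge\<close> on \<open>[0, 1]\<close>, the upper bound comes from the single point \<open>0\<close>.
\<close>

lemma J_const_pos_finite:
  assumes "r > 0"
  obtains j where "j > 0" "J_const r = ennreal j"
proof -
  let ?U = "uniform_measure lborel {0..1::real}"
  have U: "distortion r ?U A = (\<integral>\<^sup>+x\<in>{0..1}. ennreal (quant_dist x A powr r) \<partial>lborel)"
    if "finite A" "A \<noteq> {}" for A
  proof -
    have [measurable]: "(\<lambda>x. quant_dist x A) \<in> borel_measurable borel"
      using that by (rule quant_dist_measurable)
    show ?thesis unfolding distortion_def by (subst nn_integral_uniform_measure) (auto simp: divide_ennreal_def)
  qed
  define k where "k = 1 / 2 * (1 / 8 :: real) powr r"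
  have "ennreal k \<le> ennreal (real n powr r) * min_distortion r n ?U" if n: "n \<ge> 1" for n
  proof -
    have k: "k = real n powr r * (1 / 2 * (1 / (8 * real n)) powr r)"
      using n by (simp add: k_def powr_divide powr_mult)
    have "ennreal (1 / 2 * (1 / (8 * real n)) powr r) \<le> min_distortion r n ?U"
      unfolding min_distortion_def
    proof (rule INF_greatest)
      fix A assume "A \<in> {A. quantizer n A}"
      then have A: "finite A" "A \<noteq> {}" "card A \<le> n" by (auto simp: quantizer_def)
      have "card (A \<inter> {0..0 + 1}) \<le> card A" using A by (intro card_mono) auto
      then have card: "card (A \<inter> {0..0 + 1}) \<le> n" using A by simp
      have "1 / 2 * (1 / (8 * real n)) powr r \<le> 1 / 2 * (1 / (4 * (real n + 1))) powr r"
        using n assms by (intro mult_left_mono powr_mono2) (auto simp: field_simps)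
      also have "ennreal \<dots> \<le> (\<integral>\<^sup>+x\<in>{0..<0 + 1}. ennreal (quant_dist x A powr r) \<partial>lborel)"
        by (rule interval_distortion_ge[OF A(1,2) _ assms card]) simp
      also have "\<dots> \<le> distortion r ?U A"
        unfolding U[OF A(1,2)] by (intro nn_integral_mono) (auto simp: indicator_def)
      finally show "ennreal (1 / 2 * (1 / (8 * real n)) powr r) \<le> distortion r ?U A"
        by (simp add: ennreal_leI)
    qed
    then show ?thesis unfolding k by (subst ennreal_mult) (auto intro: mult_left_mono)
  qed
  then have lower: "ennreal k \<le> J_const r" unfolding J_const_def by (intro INF_greatest) auto
  have "J_const r \<le> ennreal (real 1 powr r) * min_distortion r 1 ?U"
    unfolding J_const_def by (rule INF_lower) simp
  also have "\<dots> = min_distortion r 1 ?U" by simp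
  also have "\<dots> \<le> distortion r ?U {0}"
    unfolding min_distortion_def by (rule INF_lower) (simp add: quantizer_def)
  also have "\<dots> \<le> (\<integral>\<^sup>+x. indicator {0..1::real} x \<partial>lborel)"
  proof -
    have "\<bar>x\<bar> powr r \<le> 1" if "0 \<le> x" "x \<le> 1" for x :: real
      using powr_mono2[of r "\<bar>x\<bar>" 1] that assms by simp
    then have "(\<integral>\<^sup>+x\<in>{0..1}. ennreal (quant_dist x {0} powr r) \<partial>lborel)
        \<le> (\<integral>\<^sup>+x. indicator {0..1::real} x \<partial>lborel)"
      by (intro nn_integral_mono) (simp add: quant_dist_def indicator_def)
    then show ?thesis by (subst U) auto
  qed
  also have "\<dots> = 1" by simp
  finally have "J_const r < \<infinity>" by (simp add: order_le_less_trans)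
  then obtain j where j: "J_const r = ennreal j" "j \<ge> 0" by (cases "J_const r") auto
  have "k > 0" by (simp add: k_def)
  then have "j > 0" using lower j by (simp add: ennreal_le_iff)
  then show thesis using j that by blast
qed

lemma Q_const_exponential_pos_finite:
  assumes "r > 0" "l > 0"
  obtains q where "q > 0" "Q_const r (exponential_density l) = ennreal q"
proof -
  obtain j where j: "j > 0" "J_const r = ennreal j" using J_const_pos_finite[OF assms(1)] .
  define i where "i = l powr (1 / (1 + r)) / (l / (1 + r))"
  have "(\<integral>\<^sup>+x. ennreal (exponential_density l x powr (1 / (1 + r))) \<partial>lborel)
      = (\<integral>\<^sup>+x\<in>{0..}. ennreal ((l * exp (- (l * x))) powr (1 / (1 + r))) \<partial>lborel)"
    by (intro nn_integral_cong) (auto simp: exponential_density_def indicator_def mult.commute)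
  also have "\<dots> = ennreal i"
    unfolding i_def using assms
    by (intro nn_integral_scaled_exp_decay) (auto simp: powr_mult exp_powr_real)
  finally have i: "(\<integral>\<^sup>+x. ennreal (exponential_density l x powr (1 / (1 + r))) \<partial>lborel) = ennreal i" .
  have "i > 0" using assms by (simp add: i_def)
  then have "Q_const r (exponential_density l) = ennreal (j * i powr (1 + r))"
    using j by (simp add: Q_const_def i ennreal_powr_ennreal ennreal_mult)
  moreover have "j * i powr (1 + r) > 0" using j \<open>i > 0\<close> by simp
  ultimately show thesis using that by blast
qed

lemma nn_integral_exponential_support:
  assumes "l > 0"
  shows "(\<integral>\<^sup>+x\<in>{x. exponential_density l x > 0}. g x \<partial>lborel) = (\<integral>\<^sup>+x\<in>{0..}. g x \<partial>lborel)"
proof -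
  have "{x. exponential_density l x > 0} = {0..}"
    using assms by (auto simp: exponential_density_def)
  then show ?thesis by simp
qed

lemma Q_Sup_exponential_greater:
  assumes "r > 0" "s > r" "l > 0" "C > 0" "\<theta> > s / (r + 1)"
  shows "Q_Sup r s C (exponential_density l) \<theta>
    = ennreal (C * l powr - (s / (1 + r)) * (\<theta> powr (s + 1) * (\<theta> - s / (r + 1)) powr - 1))"
proof -
  have "s / (r + 1) > 0" using assms by simp
  then have \<theta>: "\<theta> > 0" using assms by linarith
  define c where "c = l * (\<theta> - s / (r + 1))"
  have c: "c > 0" using assms by (simp add: c_def)
  have "(\<integral>\<^sup>+x\<in>{x. exponential_density l x > 0}.
          ennreal (exponential_density l (\<theta> * x) * exponential_density l x powr - (s / (1 + r))) \<partial>lborel)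
      = ennreal (l * l powr - (s / (1 + r)) / c)"
    unfolding nn_integral_exponential_support[OF assms(3)]
  proof (rule nn_integral_scaled_exp_decay)
    fix x :: real assume x: "x \<ge> 0"
    then have "\<not> \<theta> * x < 0" using \<theta> by (simp add: not_less)
    have "exponential_density l (\<theta> * x) * exponential_density l x powr - (s / (1 + r))
        = l * l powr - (s / (1 + r)) * (exp (- (\<theta> * x * l)) * exp (- (x * l) * - (s / (1 + r))))"
      using x \<open>\<not> \<theta> * x < 0\<close> assms by (simp add: exponential_density_def powr_mult exp_powr_real)
    also have "exp (- (\<theta> * x * l)) * exp (- (x * l) * - (s / (1 + r))) = exp (- (c * x))"
      unfolding c_def by (simp add: algebra_simps flip: exp_add)
    finally show "exponential_density l (\<theta> * x) * exponential_density l x powr - (s / (1 + r))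
        = l * l powr - (s / (1 + r)) * exp (- (c * x))" .
  qed (use assms c in auto)
  also have "l * l powr - (s / (1 + r)) / c = l powr - (s / (1 + r)) * (\<theta> - s / (r + 1)) powr - 1"
    using assms by (simp add: c_def powr_minus_divide)
  finally show ?thesis
    using assms by (simp add: Q_Sup_def ennreal_mult[symmetric] mult_ac)
qed

lemma Q_Sup_exponential_less:
  assumes "s > 0" "s < r" "l > 0"
  obtains K where "K > 0" "\<And>\<theta>. \<theta> > s / r \<Longrightarrow> Q_Sup r s C (exponential_density l) \<theta>
    = ennreal (K * (\<theta> powr (s + 1) * (\<theta> - s / r) powr - (1 - s / r)))"
proof -
  have r: "r > 0" using assms by simp
  obtain q where q: "q > 0" "Q_const r (exponential_density l) = ennreal q"
    using Q_const_exponential_pos_finite[OF r assms(3)] .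
  define K where "K = q powr (s / r) * ((r - s) / r) powr (1 - s / r)"
  have "K > 0" using q assms r by (simp add: K_def)
  moreover have "Q_Sup r s C (exponential_density l) \<theta>
    = ennreal (K * (\<theta> powr (s + 1) * (\<theta> - s / r) powr - (1 - s / r)))" if t: "\<theta> > s / r" for \<theta>
  proof -
    have "s / r > 0" using assms r by simp
    then have \<theta>: "\<theta> > 0" using t by linarith
    define c where "c = l * (\<theta> * r - s) / (r - s)"
    have tr: "\<theta> * r - s > 0" using t r by (simp add: field_simps)
    have c: "c > 0" using assms tr by (simp add: c_def)
    define a where "a = r / (r - s)"
    define b where "b = s / (r - s)"
    have ab: "a - b = 1" unfolding a_def b_def using assms by (simp flip: diff_divide_distrib)
    have "(\<integral>\<^sup>+x\<in>{x. exponential_density l x > 0}.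
            ennreal (exponential_density l (\<theta> * x) powr a * exponential_density l x powr - b) \<partial>lborel)
        = ennreal (l / c)"
      unfolding nn_integral_exponential_support[OF assms(3)]
    proof (rule nn_integral_scaled_exp_decay)
      fix x :: real assume x: "x \<ge> 0"
      then have "\<not> \<theta> * x < 0" using \<theta> by (simp add: not_less)
      have "exponential_density l (\<theta> * x) powr a * exponential_density l x powr - b
          = (l powr a * l powr - b) * (exp (- (\<theta> * x * l) * a) * exp (- (x * l) * - b))"
        using x \<open>\<not> \<theta> * x < 0\<close> assms by (simp add: exponential_density_def powr_mult exp_powr_real)
      also have "l powr a * l powr - b = l"
        using assms ab by (simp flip: powr_add)
      also have "exp (- (\<theta> * x * l) * a) * exp (- (x * l) * - b) = exp (- (c * x))"
        unfolding c_def a_def b_def by (simp add: algebra_simps diff_divide_distrib flip: exp_add)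
      finally show "exponential_density l (\<theta> * x) powr a * exponential_density l x powr - b
          = l * exp (- (c * x))" .
    qed (use assms c in auto)
    also have "l / c = (r - s) / r * (1 / (\<theta> - s / r))"
      unfolding c_def using assms r tr t by (simp add: field_simps)
    finally have int: "(\<integral>\<^sup>+x\<in>{x. exponential_density l x > 0}.
            ennreal (exponential_density l (\<theta> * x) powr a * exponential_density l x powr - b) \<partial>lborel)
        = ennreal ((r - s) / r * (1 / (\<theta> - s / r)))" .
    have "((r - s) / r * (1 / (\<theta> - s / r))) powr (1 - s / r)
        = ((r - s) / r) powr (1 - s / r) * (\<theta> - s / r) powr - (1 - s / r)"
      using assms r t by (subst powr_mult) (auto simp only: powr_divide powr_minus_divide powr_one_eq_one)
    then show ?thesis
      using assms r t q int
      by (simp add: Q_Sup_def K_def ennreal_powr_ennreal a_def b_def ennreal_mult[symmetric] mult_ac)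
  qed
  ultimately show thesis using that by blast
qed

section \<open>The optimal scaling of quantizers of the exponential law\<close>

theorem proposition5p4:
  fixes M :: "'a measure" and X :: "'a \<Rightarrow> real" and P :: "real measure"
    and r s l C :: real and \<alpha> :: "nat \<Rightarrow> real set"
  assumes "r > 0" and "s > 0" and "l > 0" and "C > 0"
    and "prob_space M"
    and "distributed M lborel X (exponential_density l)"
    and "P = distr M lborel X"
    and "optimal_quantizers r P \<alpha>"
  shows "(s \<in> {r<..<r + 1} \<union> {r + 1<..} \<longrightarrow>
            (\<forall>\<theta>>0. rate_optimal s P (\<lambda>n. (\<lambda>a. \<theta> * a) ` \<alpha> n) \<longleftrightarrow> \<theta> \<in> {s / (r + 1)<..}) \<and>
            (\<forall>t. is_arg_min (Q_Sup r s C (exponential_density l)) (\<lambda>\<theta>. \<theta> \<in> {s / (r + 1)<..}) t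
                 \<longleftrightarrow> t = (s + 1) / (r + 1)))
       \<and> (s \<in> {0<..<r} \<longrightarrow>
            (\<forall>\<theta>\<in>{s / r<..}. rate_optimal s P (\<lambda>n. (\<lambda>a. \<theta> * a) ` \<alpha> n)) \<and>
            (\<forall>t. is_arg_min (Q_Sup r s C (exponential_density l)) (\<lambda>\<theta>. \<theta> \<in> {s / r<..}) t
                 \<longleftrightarrow> t = (s + 1) / (r + 1)))"
proof -
  have P: "P = exp_law l"
    using assms(6,7) by (simp add: distributed_def)
  interpret optimal_for_exp_law l r \<alpha>
    using assms P by unfold_locales auto
  have rate: "rate_optimal s P (\<lambda>n. (\<lambda>a. \<theta> * a) ` \<alpha> n) \<longleftrightarrow> s / (r + 1) < \<theta>" if "\<theta> > 0" for \<theta>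
    using rate_optimal_scaled not_rate_optimal_scaled assms(2) that unfolding P by (meson not_less)
  have a: "is_arg_min (Q_Sup r s C (exponential_density l)) (\<lambda>\<theta>. \<theta> \<in> {s / (r + 1)<..}) t
      \<longleftrightarrow> t = (s + 1) / (r + 1)" if "s > r" for t
  proof -
    have "is_arg_min (Q_Sup r s C (exponential_density l)) (\<lambda>\<theta>. \<theta> \<in> {s / (r + 1)<..}) t
        \<longleftrightarrow> t = (s + 1) * (s / (r + 1)) / (s + 1 - 1)"
      by (rule is_arg_min_powr_quotient[OF Q_Sup_exponential_greater]) (use assms that in auto)
    also have "(s + 1) * (s / (r + 1)) / (s + 1 - 1) = (s + 1) / (r + 1)"
      using assms by simp
    finally show ?thesis .
  qed
  have b: "is_arg_min (Q_Sup r s C (exponential_density l)) (\<lambda>\<theta>. \<theta> \<in> {s / r<..}) t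
      \<longleftrightarrow> t = (s + 1) / (r + 1)" if sr: "s < r" for t
  proof -
    obtain K where K: "K > 0" "\<And>\<theta>. \<theta> > s / r \<Longrightarrow> Q_Sup r s C (exponential_density l) \<theta>
        = ennreal (K * (\<theta> powr (s + 1) * (\<theta> - s / r) powr - (1 - s / r)))"
      using Q_Sup_exponential_less[OF \<open>s > 0\<close> sr \<open>l > 0\<close>] by blast
    have q: "0 < 1 - s / r" "1 - s / r < s + 1" "0 < s / r" using assms sr by (auto intro: less_trans[of _ 0])
    have "is_arg_min (Q_Sup r s C (exponential_density l)) (\<lambda>\<theta>. \<theta> \<in> {s / r<..}) t
        \<longleftrightarrow> t = (s + 1) * (s / r) / (s + 1 - (1 - s / r))"
      by (rule is_arg_min_powr_quotient[OF K(2,1) q])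
    also have "s + 1 - (1 - s / r) = s / r * (r + 1)" using assms by (simp add: field_simps)
    also have "(s + 1) * (s / r) / (s / r * (r + 1)) = (s + 1) / (r + 1)"
      using assms by simp
    finally show ?thesis .
  qed
  have "s / (r + 1) < s / r" using assms by (simp add: frac_less2)
  then have "rate_optimal s P (\<lambda>n. (\<lambda>a. \<theta> * a) ` \<alpha> n)" if "\<theta> > s / r" for \<theta>
    using rate[of \<theta>] that assms by (meson divide_pos_pos less_trans)
  then show ?thesis using rate a b by auto
qed

end
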